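(* Let $\pi:E\to M$ be a (smooth, real) vector bundle over a connected manifold $M$ and let $\nabla$ be a linear connection in $\pi$. Let $\sigma:U\to E$ be a non-zero $\nabla$-parallel section of $\pi$ defined on an open subset $U$ of $M$ whose complement $F:=M\setminus U$ is contained in a smooth submanifold of $M$ of codimension greater than or equal to $2$. Then $\sigma$ can be extended to the whole of $M$ as a $\nabla$-parallel section, i.e. there is a smooth section $\widetilde\sigma:M\to E$ with $\nabla\widetilde\sigma=0$ and $\widetilde\sigma|_U=\sigma$.
   Context: A section $\sigma$ of $\pi$ over an open set $U$ is $\nabla$-parallel if $\nabla_X\sigma=0$ for every vector field $X$ on $U$. *)

theory Defs
  imports "HOL-Analysis.Analysis"
begin

section \<open>Smooth maps between open subsets of Euclidean spaces\<close>

text \<open>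
  The set \<open>S\<close> is meant to be open. Being of class \<open>C^(k+1)\<close> is expressed by the
  directional derivatives \<open>x \<mapsto> df(x)v\<close> being of class \<open>C^k\<close> for all \<open>v\<close>, which in
  finite dimension amounts to \<open>df\<close> being of class \<open>C^k\<close>.
\<close>

primrec Ck_on :: "nat \<Rightarrow> 'x::euclidean_space set \<Rightarrow> ('x \<Rightarrow> 'y::euclidean_space) \<Rightarrow> bool" where
  "Ck_on 0 S f \<longleftrightarrow> continuous_on S f"
| "Ck_on (Suc k) S f \<longleftrightarrow>
     (\<forall>x\<in>S. f differentiable (at x)) \<and>
     (\<forall>v. Ck_on k S (\<lambda>x. frechet_derivative f (at x) v))"

definition smooth_on :: "'x::euclidean_space set \<Rightarrow> ('x \<Rightarrow> 'y::euclidean_space) \<Rightarrow> bool" where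
  "smooth_on S f \<longleftrightarrow> (\<forall>k. Ck_on k S f)"


section \<open>Smooth manifolds\<close>

text \<open>
  The underlying set of a manifold is a whole type, with the topology of the type
  class \<open>topological_space\<close>; Hausdorff and second countable are type class
  assumptions. A chart is a pair \<open>(V, \<phi>)\<close>, where only the values of \<open>\<phi>\<close> on \<open>V\<close>
  matter and the inverse chart is \<open>inv_into V \<phi>\<close>.
\<close>

type_synonym ('m, 'x) chart = "'m set \<times> ('m \<Rightarrow> 'x)"

definition is_chart :: "('m::topological_space, 'x::euclidean_space) chart \<Rightarrow> bool" where
  "is_chart = (\<lambda>(V, \<phi>). open V \<and> open (\<phi> ` V) \<and> homeomorphism V (\<phi> ` V) \<phi> (inv_into V \<phi>))"

definition compatible ::
    "('m::topological_space, 'x::euclidean_space) chart \<Rightarrow> ('m, 'x) chart \<Rightarrow> bool" where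
  "compatible = (\<lambda>(V, \<phi>) (W, \<psi>).
     smooth_on (\<phi> ` (V \<inter> W)) (\<psi> \<circ> inv_into V \<phi>) \<and>
     smooth_on (\<psi> ` (V \<inter> W)) (\<phi> \<circ> inv_into W \<psi>))"

definition smooth_atlas :: "('m::topological_space, 'x::euclidean_space) chart set \<Rightarrow> bool" where
  "smooth_atlas A \<longleftrightarrow>
     (\<forall>c\<in>A. is_chart c) \<and> (\<Union>c\<in>A. fst c) = UNIV \<and> (\<forall>c\<in>A. \<forall>d\<in>A. compatible c d)"

definition smooth_structure :: "('m::topological_space, 'x::euclidean_space) chart set \<Rightarrow> bool" where
  "smooth_structure A \<longleftrightarrow>
     smooth_atlas A \<and> (\<forall>c. is_chart c \<and> (\<forall>d\<in>A. compatible c d) \<longrightarrow> c \<in> A)"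

text \<open>
  The following two atlases are not maximal. This is harmless, as they are only used to
  express smoothness of maps into or out of the respective manifold.
\<close>

definition euclidean_atlas :: "('x::euclidean_space, 'x) chart set" where
  "euclidean_atlas = {(UNIV, id)}"

definition prod_atlas ::
    "('m::topological_space, 'x::euclidean_space) chart set \<Rightarrow>
     ('n::topological_space, 'y::euclidean_space) chart set \<Rightarrow> ('m \<times> 'n, 'x \<times> 'y) chart set" where
  "prod_atlas A B = {(V \<times> W, map_prod \<phi> \<psi>) | V \<phi> W \<psi>. (V, \<phi>) \<in> A \<and> (W, \<psi>) \<in> B}"

text \<open>Smoothness of \<open>f\<close> on an open set \<open>W\<close>.\<close>

definition smooth_map ::
    "('m::topological_space, 'x::euclidean_space) chart set \<Rightarrow>
     ('n::topological_space, 'y::euclidean_space) chart set \<Rightarrow> 'm set \<Rightarrow> ('m \<Rightarrow> 'n) \<Rightarrow> bool" where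
  "smooth_map A B W f \<longleftrightarrow>
     continuous_on W f \<and>
     (\<forall>(V, \<phi>)\<in>A. \<forall>(V', \<psi>)\<in>B.
        smooth_on (\<phi> ` (V \<inter> W \<inter> f -` V')) (\<psi> \<circ> f \<circ> inv_into V \<phi>))"

definition smooth_functions ::
    "('m::topological_space, 'x::euclidean_space) chart set \<Rightarrow> ('m \<Rightarrow> real) set" where
  "smooth_functions A = {f. smooth_map A euclidean_atlas UNIV f}"

text \<open>
  Embedded (not necessarily closed) submanifolds of codimension \<open>k\<close>, by slice charts:
  \<open>A\<close> is meant to be a maximal atlas.
\<close>

definition embedded_submanifold ::
    "('m::topological_space, 'x::euclidean_space) chart set \<Rightarrow> nat \<Rightarrow> 'm set \<Rightarrow> bool" where
  "embedded_submanifold A k N \<longleftrightarrow>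
     (\<forall>p\<in>N. \<exists>(V, \<phi>)\<in>A. p \<in> V \<and>
        (\<exists>L. subspace L \<and> dim L + k = DIM('x) \<and> \<phi> ` (V \<inter> N) = \<phi> ` V \<inter> L))"


section \<open>Tangent vectors and vector fields\<close>

text \<open>
  Tangent vectors at \<open>p\<close> are the derivations at \<open>p\<close> of the algebra of smooth functions on
  the whole manifold. Requiring the value 0 outside this algebra makes the representation
  of a derivation as a total function unique.
\<close>

definition tangent_space ::
    "('m::topological_space, 'x::euclidean_space) chart set \<Rightarrow> 'm \<Rightarrow> (('m \<Rightarrow> real) \<Rightarrow> real) set" where
  "tangent_space A p = {v.
     (\<forall>f\<in>smooth_functions A. \<forall>g\<in>smooth_functions A. \<forall>a b.
        v (\<lambda>q. a * f q + b * g q) = a * v f + b * v g) \<and>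
     (\<forall>f\<in>smooth_functions A. \<forall>g\<in>smooth_functions A.
        v (\<lambda>q. f q * g q) = v f * g p + f p * v g) \<and>
     (\<forall>f. f \<notin> smooth_functions A \<longrightarrow> v f = 0)}"

type_synonym 'm vfield = "'m \<Rightarrow> ('m \<Rightarrow> real) \<Rightarrow> real"

definition vector_field_on ::
    "('m::topological_space, 'x::euclidean_space) chart set \<Rightarrow> 'm set \<Rightarrow> 'm vfield \<Rightarrow> bool" where
  "vector_field_on A W X \<longleftrightarrow>
     (\<forall>p\<in>W. X p \<in> tangent_space A p) \<and>
     (\<forall>f\<in>smooth_functions A. smooth_map A euclidean_atlas W (\<lambda>p. X p f))"


section \<open>Vector bundles\<close>

definition real_vector_space_on ::
    "'e set \<Rightarrow> ('e \<Rightarrow> 'e \<Rightarrow> 'e) \<Rightarrow> 'e \<Rightarrow> (real \<Rightarrow> 'e \<Rightarrow> 'e) \<Rightarrow> bool" where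
  "real_vector_space_on S pl z sc \<longleftrightarrow>
     z \<in> S \<and>
     (\<forall>u\<in>S. \<forall>v\<in>S. pl u v \<in> S) \<and>
     (\<forall>a. \<forall>u\<in>S. sc a u \<in> S) \<and>
     (\<forall>u\<in>S. \<forall>v\<in>S. \<forall>w\<in>S. pl (pl u v) w = pl u (pl v w)) \<and>
     (\<forall>u\<in>S. \<forall>v\<in>S. pl u v = pl v u) \<and>
     (\<forall>u\<in>S. pl z u = u) \<and>
     (\<forall>u\<in>S. \<exists>v\<in>S. pl u v = z) \<and>
     (\<forall>a. \<forall>u\<in>S. \<forall>v\<in>S. sc a (pl u v) = pl (sc a u) (sc a v)) \<and>
     (\<forall>a b. \<forall>u\<in>S. sc (a + b) u = pl (sc a u) (sc b u)) \<and>
     (\<forall>a b. \<forall>u\<in>S. sc a (sc b u) = sc (a * b) u) \<and>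
     (\<forall>u\<in>S. sc 1 u = u)"

text \<open>
  The base \<open>'m\<close> is modelled on \<open>'x\<close>, the typical fibre is \<open>'f\<close>, and the total space \<open>'e\<close>
  is a manifold in its own right. The operation \<open>fadd\<close> is meaningful only for two
  arguments in the same fibre.
\<close>

record ('m, 'e, 'x, 'f) vbundle =
  base   :: "('m, 'x) chart set"
  total  :: "('e, 'x \<times> 'f) chart set"
  proj   :: "'e \<Rightarrow> 'm"
  fzero  :: "'m \<Rightarrow> 'e"
  fadd   :: "'e \<Rightarrow> 'e \<Rightarrow> 'e"
  fscale :: "real \<Rightarrow> 'e \<Rightarrow> 'e"

definition fibre :: "('m, 'e, 'x, 'f) vbundle \<Rightarrow> 'm \<Rightarrow> 'e set" where
  "fibre B p = {e. proj B e = p}"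

text \<open>
  A local trivialization over \<open>V\<close> is given by the second component \<open>\<Phi>\<close> of a fibrewise
  linear diffeomorphism from the preimage of \<open>V\<close> onto \<open>V \<times> 'f\<close>.
\<close>

definition local_trivialization ::
    "('m::topological_space, 'e::topological_space, 'x::euclidean_space, 'f::euclidean_space) vbundle \<Rightarrow>
     'm set \<Rightarrow> ('e \<Rightarrow> 'f) \<Rightarrow> bool" where
  "local_trivialization B V \<Phi> \<longleftrightarrow>
     (let E\<^sub>V = proj B -` V; \<Psi> = (\<lambda>e. (proj B e, \<Phi> e)) in
        open V \<and>
        bij_betw \<Psi> E\<^sub>V (V \<times> UNIV) \<and>
        smooth_map (total B) (prod_atlas (base B) euclidean_atlas) E\<^sub>V \<Psi> \<and>
        smooth_map (prod_atlas (base B) euclidean_atlas) (total B) (V \<times> UNIV) (inv_into E\<^sub>V \<Psi>) \<and>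
        (\<forall>p\<in>V. \<forall>u\<in>fibre B p. \<forall>v\<in>fibre B p. \<Phi> (fadd B u v) = \<Phi> u + \<Phi> v) \<and>
        (\<forall>p\<in>V. \<forall>u\<in>fibre B p. \<forall>a. \<Phi> (fscale B a u) = a *\<^sub>R \<Phi> u))"

definition vector_bundle ::
    "('m::topological_space, 'e::topological_space, 'x::euclidean_space, 'f::euclidean_space) vbundle \<Rightarrow>
     bool" where
  "vector_bundle B \<longleftrightarrow>
     smooth_structure (base B) \<and>
     smooth_structure (total B) \<and>
     smooth_map (total B) (base B) UNIV (proj B) \<and>
     surj (proj B) \<and>
     (\<forall>p. real_vector_space_on (fibre B p) (fadd B) (fzero B p) (fscale B)) \<and>
     (\<forall>p. \<exists>V \<Phi>. p \<in> V \<and> local_trivialization B V \<Phi>)"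

definition section_on ::
    "('m::topological_space, 'e::topological_space, 'x::euclidean_space, 'f::euclidean_space) vbundle \<Rightarrow>
     'm set \<Rightarrow> ('m \<Rightarrow> 'e) \<Rightarrow> bool" where
  "section_on B W \<sigma> \<longleftrightarrow> (\<forall>p\<in>W. \<sigma> p \<in> fibre B p) \<and> smooth_map (base B) (total B) W \<sigma>"


section \<open>Linear connections and parallel sections\<close>

text \<open>
  A linear connection is a covariant derivative, acting on global vector fields and global
  sections. Its values on other arguments are unconstrained.
\<close>

definition linear_connection ::
    "('m::topological_space, 'e::topological_space, 'x::euclidean_space, 'f::euclidean_space) vbundle \<Rightarrow>
     ('m vfield \<Rightarrow> ('m \<Rightarrow> 'e) \<Rightarrow> 'm \<Rightarrow> 'e) \<Rightarrow> bool" where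
  "linear_connection B D \<longleftrightarrow>
     (\<forall>X \<sigma>. vector_field_on (base B) UNIV X \<and> section_on B UNIV \<sigma> \<longrightarrow>
        section_on B UNIV (D X \<sigma>) \<and>
        (\<forall>Y. vector_field_on (base B) UNIV Y \<longrightarrow>
           (\<forall>p. D (\<lambda>q h. X q h + Y q h) \<sigma> p = fadd B (D X \<sigma> p) (D Y \<sigma> p))) \<and>
        (\<forall>f\<in>smooth_functions (base B).
           \<forall>p. D (\<lambda>q h. f q * X q h) \<sigma> p = fscale B (f p) (D X \<sigma> p)) \<and>
        (\<forall>\<tau>. section_on B UNIV \<tau> \<longrightarrow>
           (\<forall>p. D X (\<lambda>q. fadd B (\<sigma> q) (\<tau> q)) p = fadd B (D X \<sigma> p) (D X \<tau> p))) \<and>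
        (\<forall>f\<in>smooth_functions (base B).
           \<forall>p. D X (\<lambda>q. fscale B (f q) (\<sigma> q)) p =
               fadd B (fscale B (X p f) (\<sigma> p)) (fscale B (f p) (D X \<sigma> p))))"

text \<open>
  The connection induced on an open subset \<open>W\<close>: by locality of \<open>D\<close>, its value at
  \<open>p \<in> W\<close> is the common value at \<open>p\<close> of all \<open>D Y \<tau>\<close>, where \<open>Y\<close> and \<open>\<tau>\<close> are globally
  defined and agree with \<open>X\<close> and \<open>\<sigma>\<close> near \<open>p\<close>. Such \<open>Y\<close> and \<open>\<tau>\<close> always exist.
\<close>

definition induced_connection ::
    "('m::topological_space, 'e::topological_space, 'x::euclidean_space, 'f::euclidean_space) vbundle \<Rightarrow>
     ('m vfield \<Rightarrow> ('m \<Rightarrow> 'e) \<Rightarrow> 'm \<Rightarrow> 'e) \<Rightarrow> 'm set \<Rightarrow> 'm vfield \<Rightarrow> ('m \<Rightarrow> 'e) \<Rightarrow> 'm \<Rightarrow> 'e" where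
  "induced_connection B D W X \<sigma> p =
     (THE e. \<exists>Y \<tau> O'. vector_field_on (base B) UNIV Y \<and> section_on B UNIV \<tau> \<and>
        open O' \<and> p \<in> O' \<and> O' \<subseteq> W \<and> (\<forall>q\<in>O'. Y q = X q \<and> \<tau> q = \<sigma> q) \<and> e = D Y \<tau> p)"

definition parallel_section_on ::
    "('m::topological_space, 'e::topological_space, 'x::euclidean_space, 'f::euclidean_space) vbundle \<Rightarrow>
     ('m vfield \<Rightarrow> ('m \<Rightarrow> 'e) \<Rightarrow> 'm \<Rightarrow> 'e) \<Rightarrow> 'm set \<Rightarrow> ('m \<Rightarrow> 'e) \<Rightarrow> bool" where
  "parallel_section_on B D W \<sigma> \<longleftrightarrow>
     section_on B W \<sigma> \<and>
     (\<forall>X. vector_field_on (base B) W X \<longrightarrow>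
        (\<forall>p\<in>W. induced_connection B D W X \<sigma> p = fzero B p))"

end

theory Submission
  imports Defs
begin

text \<open>
  Uniqueness is easy: a submanifold of positive codimension contains no nonempty open set,
  so \<open>U\<close> is dense, and continuous maps into the Hausdorff total space that agree on \<open>U\<close> are equal
  (\<open>complement_of_submanifold_dense\<close>, \<open>continuous_eq_on_dense\<close>). Hence it is enough to extend
  \<open>\<sigma>\<close> smoothly to a neighbourhood of each point of the complement: the local extensions fit
  together to a global section \<open>\<tau>\<close>, and for every vector field \<open>X\<close> the continuous section
  \<open>\<nabla>\<^sub>X \<tau>\<close> vanishes on the dense set \<open>U\<close>, hence everywhere.

  Near a point of the complement, a slice chart and a local trivialization turn \<open>\<sigma>\<close> into a
  vector valued function \<open>s\<close> on a ball minus a closed part of a linear subspace \<open>L\<close> of codimension at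
  least two, and parallelism into a linear system \<open>\<partial>\<^sub>i s = \<Sum>\<^sub>b s\<^sub>b a\<^sub>i\<^sub>b\<close>
  whose coefficients are smooth on the whole ball (\<open>parallel_local_equation\<close>). The analytic heart is
  \<open>extend_solution_across_subspace\<close>: such an \<open>s\<close> extends smoothly. For \<open>x\<close> outside \<open>L\<close>,
  the points \<open>y\<close> for which the segment from \<open>x\<close> to \<open>y\<close> meets \<open>L\<close> all lie in the span of
  \<open>L\<close> and \<open>x\<close>, a proper subspace because the codimension is at least two. So almost every segment
  avoids \<open>L\<close>, and an estimate along such segments passes to all pairs of points by continuity.
  In this way the Gronwall inequality bounds \<open>s\<close>, and then the equation bounds its derivative
  and makes \<open>s\<close> Lipschitz, so that \<open>s\<close> extends continuously. The mean value
  inequality along generic segments shows that the extension is differentiable and solves the same system, also on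
  \<open>L\<close>, and the system itself then yields smoothness of every order.

  The linear system must be derived from a covariant derivative that acts on global objects only. Bump
  functions give its locality (\<open>connection_local\<close>), which identifies the induced connection on \<open>U\<close>
  with \<open>\<nabla>\<close> (\<open>parallel_imp_connection_zero\<close>), and they turn coordinate vector fields
  and local frames into global ones, from which the coefficients are read off (\<open>connection_cut_section\<close>).
\<close>

section \<open>Calculus of smooth maps on Euclidean spaces\<close>

lemma Ck_on_cong:
  assumes "open S" "\<And>x. x \<in> S \<Longrightarrow> f x = g x" "Ck_on k S f"
  shows "Ck_on k S g"
  using assms(2,3)
proof (induction k arbitrary: f g)
  case 0
  then show ?case using continuous_on_cong by force
next
  case (Suc k)
  have d: "(g has_derivative frechet_derivative f (at x)) (at x)" if "x \<in> S" for x
  proof (rule has_derivative_transform_within_open[OF _ assms(1) that])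
    show "(f has_derivative frechet_derivative f (at x)) (at x)"
      using Suc.prems(2) that by (simp add: frechet_derivative_works[symmetric])
  qed (rule Suc.prems(1))
  have e: "frechet_derivative f (at x) = frechet_derivative g (at x)" if "x \<in> S" for x
    using frechet_derivative_at[OF d[OF that]] .
  show ?case
    using Suc.prems d e Suc.IH[of "\<lambda>x. frechet_derivative f (at x) v" "\<lambda>x. frechet_derivative g (at x) v" for v]
    by (auto simp: differentiable_def)
qed

text \<open>
  Replaces the chosen derivative \<open>frechet_derivative\<close> by any derivative that is known in closed form, so that
  the inductions on the order below can use the usual differentiation rules.
\<close>

lemma Ck_on_SucI:
  assumes "open S" "\<And>x. x \<in> S \<Longrightarrow> (f has_derivative f' x) (at x)" "\<And>v. Ck_on k S (\<lambda>x. f' x v)"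
  shows "Ck_on (Suc k) S f"
proof -
  have "Ck_on k S (\<lambda>x. frechet_derivative f (at x) v)" for v
    by (rule Ck_on_cong[OF assms(1) _ assms(3)[of v]]) (simp add: frechet_derivative_at[OF assms(2), symmetric])
  then show ?thesis using assms(2) by (auto simp: differentiable_def)
qed

lemma Ck_on_SucD:
  assumes "Ck_on (Suc k) S f"
  shows "x \<in> S \<Longrightarrow> (f has_derivative frechet_derivative f (at x)) (at x)"
    and "Ck_on k S (\<lambda>x. frechet_derivative f (at x) v)"
  using assms by (auto simp: frechet_derivative_works)

lemma Ck_on_subset: "Ck_on k S f \<Longrightarrow> T \<subseteq> S \<Longrightarrow> Ck_on k T f"
  by (induction k arbitrary: f) (auto intro: continuous_on_subset)

lemma Ck_on_open_cover:
  assumes "\<And>x. x \<in> S \<Longrightarrow> \<exists>T. open T \<and> x \<in> T \<and> Ck_on k T f"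
  shows "Ck_on k S f"
  using assms
proof (induction k arbitrary: f)
  case 0
  have "isCont f x" if "x \<in> S" for x
    using 0[OF that] by (auto simp: continuous_on_eq_continuous_at)
  then show ?case by (simp add: continuous_at_imp_continuous_on)
next
  case (Suc k)
  show ?case unfolding Ck_on.simps
  proof (intro conjI ballI allI)
    show "f differentiable (at x)" if "x \<in> S" for x
      using Suc.prems[OF that] by auto
    show "Ck_on k S (\<lambda>x. frechet_derivative f (at x) v)" for v
      by (rule Suc.IH) (use Suc.prems in fastforce)
  qed
qed

lemma Ck_on_continuous_on: "Ck_on k S f \<Longrightarrow> continuous_on S f"
  by (cases k) (auto intro!: continuous_at_imp_continuous_on simp: differentiable_imp_continuous_within)

lemma Ck_on_Suc_imp: "Ck_on (Suc k) S f \<Longrightarrow> Ck_on k S f"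
proof (induction k arbitrary: f)
  case 0
  then show ?case using Ck_on_continuous_on by fastforce
next
  case (Suc k)
  then show ?case by simp
qed

lemma Ck_on_const: "Ck_on k S (\<lambda>x. c)"
  by (induction k arbitrary: c) auto

lemma Ck_on_bounded_linear:
  assumes "bounded_linear f" "open S" shows "Ck_on k S f"
proof (cases k)
  case 0
  then show ?thesis using assms by (simp add: linear_continuous_on)
next
  case (Suc j)
  show ?thesis unfolding Suc
    by (rule Ck_on_SucI[OF assms(2), where f' = "\<lambda>x. f"])
       (auto intro: bounded_linear_imp_has_derivative assms Ck_on_const)
qed

lemma Ck_on_add:
  assumes "open S" "Ck_on k S f" "Ck_on k S g" shows "Ck_on k S (\<lambda>x. f x + g x)"
  using assms(2,3)
proof (induction k arbitrary: f g)
  case (Suc k)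
  show ?case
    by (rule Ck_on_SucI[OF assms(1) has_derivative_add[OF Ck_on_SucD(1)[OF Suc.prems(1)] Ck_on_SucD(1)[OF Suc.prems(2)]]])
       (use Suc in auto)
qed (auto intro: continuous_on_add)

lemma Ck_on_sum:
  assumes "open S" "\<And>i. i \<in> I \<Longrightarrow> Ck_on k S (f i)" shows "Ck_on k S (\<lambda>x. \<Sum>i\<in>I. f i x)"
  using assms(2)
  by (induction I rule: infinite_finite_induct) (auto intro: Ck_on_const Ck_on_add[OF assms(1)])

lemma Ck_on_bilinear:
  assumes "bounded_bilinear h" "open S" "Ck_on k S f" "Ck_on k S g"
  shows "Ck_on k S (\<lambda>x. h (f x) (g x))"
  using assms(3,4)
proof (induction k arbitrary: f g)
  case 0
  then show ?case using bounded_bilinear.continuous_on[OF assms(1)] by auto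
next
  case (Suc k)
  show ?case
  proof (rule Ck_on_SucI[OF assms(2)])
    show "((\<lambda>x. h (f x) (g x)) has_derivative
       (\<lambda>v. h (f x) (frechet_derivative g (at x) v) + h (frechet_derivative f (at x) v) (g x))) (at x)" if "x \<in> S" for x
      by (rule bounded_bilinear.FDERIV[OF assms(1)]) (use Suc.prems that Ck_on_SucD in blast)+
    show "Ck_on k S (\<lambda>x. h (f x) (frechet_derivative g (at x) v) + h (frechet_derivative f (at x) v) (g x))" for v
      by (intro Ck_on_add[OF assms(2)] Suc.IH Ck_on_SucD(2) Suc.prems Ck_on_Suc_imp)
  qed
qed

lemma linear_componentwise_expansion:
  assumes "linear h" shows "h w = (\<Sum>b\<in>Basis. (w \<bullet> b) *\<^sub>R h b)"
proof -
  have "h w = h (\<Sum>b\<in>Basis. (w \<bullet> b) *\<^sub>R b)" by (simp add: euclidean_representation)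
  also have "\<dots> = (\<Sum>b\<in>Basis. (w \<bullet> b) *\<^sub>R h b)"
    by (simp add: linear_sum[OF assms] linear_scale[OF assms])
  finally show ?thesis .
qed

text \<open>
  The chain rule gives \<open>dg(f x)(df(x) v)\<close>, where the point and the direction both vary with \<open>x\<close>, while the induction
  hypothesis speaks of a fixed direction; hence the expansion over \<open>Basis\<close>.
\<close>

lemma Ck_on_compose:
  assumes "open S" "open T" "f ` S \<subseteq> T" "Ck_on k S f" "Ck_on k T g"
  shows "Ck_on k S (\<lambda>x. g (f x))"
  using assms(4,5)
proof (induction k arbitrary: g)
  case 0
  then show ?case using assms(3) continuous_on_compose2 by auto
next
  case (Suc k)
  let ?f' = "\<lambda>x. frechet_derivative f (at x)" and ?g' = "\<lambda>x. frechet_derivative g (at x)"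
  show ?case
  proof (rule Ck_on_SucI[OF assms(1)])
    show "((\<lambda>x. g (f x)) has_derivative (\<lambda>v. \<Sum>b\<in>Basis. (?f' x v \<bullet> b) *\<^sub>R ?g' (f x) b)) (at x)" if "x \<in> S" for x
    proof -
      have 1: "(f has_derivative ?f' x) (at x)" using Ck_on_SucD(1) Suc.prems(1) that by blast
      have 2: "(g has_derivative ?g' (f x)) (at (f x))" using Ck_on_SucD(1) Suc.prems(2) that assms(3) by blast
      have "linear (?g' (f x))" using 2 has_derivative_linear by blast
      from linear_componentwise_expansion[OF this]
      have "(\<lambda>v. ?g' (f x) (?f' x v)) = (\<lambda>v. \<Sum>b\<in>Basis. (?f' x v \<bullet> b) *\<^sub>R ?g' (f x) b)"
        by (intro ext)
      with has_derivative_compose[OF 1 2] show ?thesis by (simp only:)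
    qed
    show "Ck_on k S (\<lambda>x. \<Sum>b\<in>Basis. (?f' x v \<bullet> b) *\<^sub>R ?g' (f x) b)" for v
    proof (intro Ck_on_sum assms Ck_on_bilinear[OF bounded_bilinear_scaleR])
      fix b
      show "Ck_on k S (\<lambda>x. ?f' x v \<bullet> b)"
        by (intro Ck_on_bilinear[OF bounded_bilinear_inner] assms Ck_on_const Ck_on_SucD(2) Suc.prems)
      show "Ck_on k S (\<lambda>x. ?g' (f x) b)"
        using Suc.IH[OF Ck_on_Suc_imp[OF Suc.prems(1)] Ck_on_SucD(2)[OF Suc.prems(2)]] .
    qed
  qed
qed

lemma smooth_on_cong: "open S \<Longrightarrow> (\<And>x. x \<in> S \<Longrightarrow> f x = g x) \<Longrightarrow> smooth_on S f \<Longrightarrow> smooth_on S g"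
  unfolding smooth_on_def using Ck_on_cong by blast

lemma smooth_on_subset: "smooth_on S f \<Longrightarrow> T \<subseteq> S \<Longrightarrow> smooth_on T f"
  unfolding smooth_on_def using Ck_on_subset by blast

lemma smooth_on_open_cover:
  assumes "\<And>x. x \<in> S \<Longrightarrow> \<exists>T. open T \<and> x \<in> T \<and> smooth_on T f"
  shows "smooth_on S f"
  unfolding smooth_on_def using assms Ck_on_open_cover unfolding smooth_on_def by metis

lemma smooth_on_continuous_on: "smooth_on S f \<Longrightarrow> continuous_on S f"
  unfolding smooth_on_def using Ck_on_continuous_on by blast

lemma smooth_on_const: "smooth_on S (\<lambda>x. c)"
  unfolding smooth_on_def by (simp add: Ck_on_const)

lemma smooth_on_bounded_linear: "bounded_linear f \<Longrightarrow> open S \<Longrightarrow> smooth_on S f"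
  unfolding smooth_on_def by (simp add: Ck_on_bounded_linear)

lemma smooth_on_id: "open S \<Longrightarrow> smooth_on S (\<lambda>x. x)"
  by (rule smooth_on_bounded_linear) (rule bounded_linear_ident)

lemma smooth_on_add: "open S \<Longrightarrow> smooth_on S f \<Longrightarrow> smooth_on S g \<Longrightarrow> smooth_on S (\<lambda>x. f x + g x)"
  unfolding smooth_on_def by (simp add: Ck_on_add)

lemma smooth_on_sum:
  "open S \<Longrightarrow> (\<And>i. i \<in> I \<Longrightarrow> smooth_on S (f i)) \<Longrightarrow> smooth_on S (\<lambda>x. \<Sum>i\<in>I. f i x)"
  unfolding smooth_on_def by (simp add: Ck_on_sum)

lemma smooth_on_bilinear:
  "bounded_bilinear h \<Longrightarrow> open S \<Longrightarrow> smooth_on S f \<Longrightarrow> smooth_on S g \<Longrightarrow> smooth_on S (\<lambda>x. h (f x) (g x))"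
  unfolding smooth_on_def by (simp add: Ck_on_bilinear)

lemmas smooth_on_scaleR = smooth_on_bilinear[OF bounded_bilinear_scaleR]
  and smooth_on_inner = smooth_on_bilinear[OF bounded_bilinear_inner]
  and smooth_on_mult = smooth_on_bilinear[OF bounded_bilinear_mult[where 'a=real]]

lemma smooth_on_compose:
  "open S \<Longrightarrow> open T \<Longrightarrow> f ` S \<subseteq> T \<Longrightarrow> smooth_on S f \<Longrightarrow> smooth_on T g \<Longrightarrow> smooth_on S (\<lambda>x. g (f x))"
  unfolding smooth_on_def using Ck_on_compose by blast

lemma smooth_on_linear_compose:
  assumes "bounded_linear h" "open S" "smooth_on S f" shows "smooth_on S (\<lambda>x. h (f x))"
  by (rule smooth_on_compose[OF assms(2) open_UNIV _ assms(3) smooth_on_bounded_linear[OF assms(1) open_UNIV]]) simp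

lemma smooth_on_Pair:
  assumes "open S" "smooth_on S f" "smooth_on S g" shows "smooth_on S (\<lambda>x. (f x, g x))"
proof -
  have "smooth_on S (\<lambda>x. (f x, 0) + (0, g x))"
    by (intro smooth_on_add assms smooth_on_linear_compose[OF _ assms(1,2), of "\<lambda>y. (y, 0)"]
          smooth_on_linear_compose[OF _ assms(1,3), of "\<lambda>y. (0, y)"])
       (auto intro!: bounded_linear_intros)
  then show ?thesis by simp
qed

lemma smooth_on_differentiable:
  "smooth_on S f \<Longrightarrow> x \<in> S \<Longrightarrow> (f has_derivative frechet_derivative f (at x)) (at x)"
  unfolding smooth_on_def using Ck_on_SucD(1) by blast

lemma smooth_on_frechet_derivative:
  "smooth_on S f \<Longrightarrow> smooth_on S (\<lambda>x. frechet_derivative f (at x) v)"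
  unfolding smooth_on_def using Ck_on_SucD(2) by blast

section \<open>Smooth bump functions\<close>

lemma smooth_on_inverse: "smooth_on (- {0::real}) inverse"
proof -
  have "Ck_on k (- {0::real}) inverse" for k
  proof (induction k)
    case 0
    then show ?case by (auto intro!: continuous_intros)
  next
    case (Suc k)
    show ?case
    proof (rule Ck_on_SucI)
      show "(inverse has_derivative (\<lambda>v. - (inverse x * v * inverse x))) (at x)" if "x \<in> -{0}" for x :: real
        using has_derivative_inverse'[of x UNIV] that by simp
      show "Ck_on k (-{0}) (\<lambda>x. - (inverse x * v * inverse x))" for v :: real
      proof -
        have "Ck_on k (-{0}) (\<lambda>x. (- v) * (inverse x * inverse x))"
          by (intro Ck_on_bilinear[OF bounded_bilinear_mult] Ck_on_const Suc) auto
        then show ?thesis by (simp add: mult_ac)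
      qed
    qed auto
  qed
  then show ?thesis unfolding smooth_on_def by blast
qed

text \<open>
  The classical function \<open>exp (-1/t)\<close>, flat at \<open>0\<close>, divided by powers of \<open>t\<close>. The powers make the
  family closed under differentiation up to linear combinations, which is what an induction on the order needs.
\<close>
definition flat :: "nat \<Rightarrow> real \<Rightarrow> real" where
  "flat n t = (if t \<le> 0 then 0 else exp (- (1 / t)) / t ^ n)"

lemma flat_pos: "t > 0 \<Longrightarrow> flat n t > 0" and flat_nonneg: "flat n t \<ge> 0" and flat_zero: "t \<le> 0 \<Longrightarrow> flat n t = 0"
  by (auto simp: flat_def)

lemma power_over_fact_le_exp:
  fixes x :: real assumes "x \<ge> 0" shows "x ^ n / fact n \<le> exp x"
proof -
  obtain t where t: "exp x = (\<Sum>m<Suc n. x ^ m / fact m) + exp t / fact (Suc n) * x ^ Suc n"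
    using Maclaurin_exp_le by metis
  have "0 \<le> (\<Sum>m<n. x ^ m / fact m)" using assms by (intro sum_nonneg) simp
  moreover have "0 \<le> exp t / fact (Suc n) * x ^ Suc n" using assms by simp
  ultimately show ?thesis using t by simp
qed

text \<open>
  The bound is quadratic in \<open>t\<close>, so the difference quotient at \<open>0\<close> tends to \<open>0\<close>.
\<close>

lemma flat_le: "\<bar>flat n t\<bar> \<le> fact (n + 2) * t\<^sup>2"
proof (cases "t \<le> 0")
  case False
  then have t: "t > 0" by simp
  have "(1 / t) ^ (n + 2) / fact (n + 2) \<le> exp (1 / t)"
    by (rule power_over_fact_le_exp) (use t in simp)
  moreover have "exp (- (1 / t)) \<le> F * t ^ m" if "(1 / t) ^ m / F \<le> exp (1 / t)" "F > 0" for F :: real and m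
    using that t by (simp add: exp_minus field_simps)
  ultimately have "exp (- (1 / t)) \<le> fact (n + 2) * t ^ (n + 2)"
    by (metis fact_gt_zero)
  then have "exp (- (1 / t)) \<le> (fact (n + 2) * t\<^sup>2) * t ^ n"
    by (simp only: power_add mult_ac)
  then show ?thesis using t by (simp add: flat_def divide_le_eq del: fact_Suc)
qed (simp add: flat_def)

lemma flat_has_derivative:
  "(flat n has_real_derivative (flat (n + 2) t - real n * flat (n + 1) t)) (at t)"
proof -
  consider "t < 0" | "t = 0" | "t > 0" by linarith
  then show ?thesis
  proof cases
    case 1
    have "(flat n has_real_derivative 0) (at t)"
      by (rule has_field_derivative_transform_within_open[of "\<lambda>_. 0" _ _ "{..<0}"]) (use 1 in \<open>auto simp: flat_def\<close>)
    then show ?thesis using 1 by (simp add: flat_def)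
  next
    case 2
    obtain C :: real where C: "\<And>h. \<bar>flat n h\<bar> \<le> C * h\<^sup>2" using flat_le by blast
    have "((\<lambda>h. flat n h / h) \<longlongrightarrow> 0) (at 0)"
    proof (rule Lim_null_comparison)
      show "\<forall>\<^sub>F h in at 0. norm (flat n h / h) \<le> C * \<bar>h\<bar>"
      proof (rule eventually_at_filter[THEN iffD2], rule always_eventually, intro allI impI)
        fix h :: real assume "h \<noteq> 0"
        then show "norm (flat n h / h) \<le> C * \<bar>h\<bar>"
          using C[of h] by (simp add: divide_le_eq power2_eq_square mult.assoc)
      qed
      show "((\<lambda>h. C * \<bar>h\<bar>) \<longlongrightarrow> (0::real)) (at 0)"
        by (auto intro!: tendsto_eq_intros)
    qed
    then show ?thesis using 2 by (simp add: DERIV_def flat_def)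
  next
    case 3
    have "real n * t ^ (n - Suc 0) = real n * t ^ n / t"
      using 3 by (cases n) auto
    then have "((\<lambda>t. t ^ n) has_real_derivative real n * t ^ n / t) (at t)"
      using DERIV_pow[of n t UNIV] by simp
    moreover have "((\<lambda>t. exp (- (1 / t))) has_real_derivative exp (- (1 / t)) / t\<^sup>2) (at t)"
      using 3 by (auto intro!: derivative_eq_intros simp: power2_eq_square)
    ultimately have "((\<lambda>t. exp (- (1 / t)) / t ^ n) has_real_derivative
        (exp (- (1 / t)) / t\<^sup>2 * t ^ n - exp (- (1 / t)) * (real n * t ^ n / t)) / (t ^ n * t ^ n)) (at t)"
      using 3 by (intro DERIV_divide) auto
    moreover have "(exp (- (1 / t)) / t\<^sup>2 * t ^ n - exp (- (1 / t)) * (real n * t ^ n / t)) / (t ^ n * t ^ n)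
        = flat (n + 2) t - real n * flat (n + 1) t"
      using 3 by (simp add: flat_def field_simps power2_eq_square)
    ultimately have "((\<lambda>t. exp (- (1 / t)) / t ^ n) has_real_derivative (flat (n + 2) t - real n * flat (n + 1) t)) (at t)"
      by simp
    then show ?thesis
      by (rule has_field_derivative_transform_within_open[of _ _ _ "{0<..}"]) (use 3 in \<open>auto simp: flat_def\<close>)
  qed
qed

lemma smooth_on_flat: "smooth_on UNIV (flat n)"
proof -
  have "Ck_on k UNIV (flat n)" for k n
  proof (induction k arbitrary: n)
    case 0
    show ?case using DERIV_isCont[OF flat_has_derivative]
      by (auto intro: continuous_at_imp_continuous_on)
  next
    case (Suc k)
    show ?case
    proof (rule Ck_on_SucI)
      show "(flat n has_derivative (\<lambda>v. v * (1 * flat (n + 2) x + (- real n) * flat (n + 1) x))) (at x)" for x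
        using flat_has_derivative[of n x] by (simp add: has_field_derivative_def mult_commute_abs)
      show "Ck_on k UNIV (\<lambda>x. v * (1 * flat (n + 2) x + (- real n) * flat (n + 1) x))" for v
        by (intro Ck_on_bilinear[OF bounded_bilinear_mult] Ck_on_add Ck_on_const Suc) auto
    qed simp
  qed
  then show ?thesis unfolding smooth_on_def by blast
qed

text \<open>
  With \<open>u\<close> the squared distance from \<open>c\<close> and \<open>h = flat 0\<close>, the quotient
  \<open>h (r\<^sup>2 - u) / (h (r\<^sup>2 - u) + h (u - r\<^sup>2/4))\<close> is such a function:
  the numerator vanishes outside the ball, the second summand vanishes inside the smaller ball, and the two arguments
  are never both nonpositive.
\<close>

lemma exists_smooth_bump_ball:
  fixes c :: "'x::euclidean_space"
  assumes "r > 0"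
  obtains b :: "'x \<Rightarrow> real" where "smooth_on UNIV b" "\<And>x. x \<in> ball c (r/2) \<Longrightarrow> b x = 1" "\<And>x. x \<notin> ball c r \<Longrightarrow> b x = 0"
proof
  let ?u = "\<lambda>x. (x - c) \<bullet> (x - c)"
  let ?num = "\<lambda>x. flat 0 (r\<^sup>2 + (-1) * ?u x)" and ?den = "\<lambda>x. flat 0 (r\<^sup>2 + (-1) * ?u x) + flat 0 (?u x + - (r\<^sup>2 / 4))"
  have u: "?u x = (dist c x)\<^sup>2" for x by (metis dist_commute dist_norm power2_norm_eq_inner)
  have "smooth_on UNIV (\<lambda>x. (x + (- c)) \<bullet> (x + (- c)))"
    by (intro smooth_on_inner smooth_on_add smooth_on_id smooth_on_const open_UNIV)
  then have su: "smooth_on UNIV ?u" by simp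
  have sn: "smooth_on UNIV ?num"
    by (rule smooth_on_compose[OF _ _ _ _ smooth_on_flat])
       (intro smooth_on_add smooth_on_mult smooth_on_const su open_UNIV | simp)+
  have "smooth_on UNIV (\<lambda>x. flat 0 (?u x + - (r\<^sup>2 / 4)))"
    by (rule smooth_on_compose[OF _ _ _ _ smooth_on_flat])
       (intro smooth_on_add smooth_on_const su open_UNIV | simp)+
  then have sd: "smooth_on UNIV ?den" using sn by (intro smooth_on_add) auto
  have den: "?den x > 0" for x
  proof (cases "?u x < r\<^sup>2")
    case True
    then show ?thesis using flat_pos[of "r\<^sup>2 + (-1) * ?u x" 0] flat_nonneg[of 0 "?u x + - (r\<^sup>2 / 4)"] by linarith
  next
    case False
    moreover have "r\<^sup>2 > 0" using assms by simp
    ultimately have "?u x + - (r\<^sup>2 / 4) > 0" by linarith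
    then show ?thesis using flat_pos[of "?u x + - (r\<^sup>2 / 4)" 0] flat_nonneg[of 0 "r\<^sup>2 + (-1) * ?u x"] by linarith
  qed
  have "smooth_on UNIV (\<lambda>x. inverse (?den x))"
  proof (rule smooth_on_compose[OF _ _ _ sd smooth_on_inverse])
    show "range ?den \<subseteq> - {0}"
    proof clarify
      fix x assume "?den x = 0" then show False using den[of x] by linarith
    qed
  qed auto
  then show "smooth_on UNIV (\<lambda>x. ?num x * inverse (?den x))" using sn by (intro smooth_on_mult) auto
  show "?num x * inverse (?den x) = 1" if "x \<in> ball c (r/2)" for x
  proof -
    have "(dist c x)\<^sup>2 \<le> (r/2)\<^sup>2" using that by (intro power_mono) auto
    then have "flat 0 (?u x + - (r\<^sup>2 / 4)) = 0" by (intro flat_zero) (simp add: u power_divide)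
    then show ?thesis using den[of x] by simp
  qed
  show "?num x * inverse (?den x) = 0" if "x \<notin> ball c r" for x
  proof -
    have "(dist c x)\<^sup>2 \<ge> r\<^sup>2" using that assms by (intro power_mono) auto
    then have "?num x = 0" by (intro flat_zero) (simp add: u)
    then show ?thesis by simp
  qed
qed

section \<open>Extending solutions of linear systems across subspaces of codimension two\<close>

lemma dim_span_insert_less:
  fixes L :: "'x::euclidean_space set"
  assumes "dim L + 2 \<le> DIM('x)" shows "dim (span (insert x L)) < dim (UNIV :: 'x set)"
  using assms dim_insert[of x L] by (auto simp: dim_UNIV)

lemma exists_generic_point:
  fixes L :: "'x::euclidean_space set"
  assumes "dim L + 2 \<le> DIM('x)" "open W" "W \<noteq> {}"
  obtains y where "y \<in> W" "y \<notin> span (insert x L)"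
proof -
  have "closure (UNIV - span (insert x L)) = UNIV"
    by (rule dense_complement_subspace[OF dim_span_insert_less[OF assms(1)]]) simp
  then have "W \<inter> (UNIV - span (insert x L)) \<noteq> {}"
    using open_Int_closure_eq_empty[OF assms(2), of "UNIV - span (insert x L)"] assms(3) by auto
  then show ?thesis using that by auto
qed

text \<open>
  If the segment met \<open>L\<close> in a point other than \<open>x\<close>, then \<open>y\<close> would be a linear combination of that point and \<open>x\<close>.
\<close>

lemma generic_segment_avoids_subspace:
  assumes "subspace L" "x \<notin> L" "y \<notin> span (insert x L)" "z \<in> closed_segment x y"
  shows "z \<notin> L"
proof
  assume z: "z \<in> L"
  obtain t where t: "z = (1 - t) *\<^sub>R x + t *\<^sub>R y" using assms(4) by (auto simp: closed_segment_def)
  have "t \<noteq> 0" using t z assms(2) by auto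
  have "z \<in> span (insert x L)" "x \<in> span (insert x L)" using z by (auto intro: span_base)
  then have "(1 / t) *\<^sub>R (z - (1 - t) *\<^sub>R x) \<in> span (insert x L)"
    by (intro span_scale span_diff)
  moreover have "(1 / t) *\<^sub>R (z - (1 - t) *\<^sub>R x) = y"
    using t \<open>t \<noteq> 0\<close> by simp
  ultimately show False using assms(3) by simp
qed

text \<open>
  The pairs \<open>(x, y)\<close> whose segment avoids \<open>L\<close> are dense, as \<open>L\<close> and the span of \<open>L\<close> and \<open>x\<close>
  are proper subspaces; so a closed condition need only be checked on them. This is where the codimension enters.
\<close>

lemma le_of_le_generic_pairs:
  fixes F :: "'x::euclidean_space \<times> 'x \<Rightarrow> real"
  assumes codim: "dim L + 2 \<le> DIM('x)"
    and "open S" "continuous_on (S \<times> S) F"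
    and le: "\<And>x y. x \<in> S \<Longrightarrow> y \<in> S \<Longrightarrow> x \<notin> L \<Longrightarrow> y \<notin> span (insert x L) \<Longrightarrow> F (x, y) \<le> 0"
    and "x \<in> S" "y \<in> S"
  shows "F (x, y) \<le> 0"
proof (rule ccontr)
  assume "\<not> F (x, y) \<le> 0"
  let ?P = "(S \<times> S) \<inter> F -` {0<..}"
  have "open ?P" using assms(2,3) by (intro continuous_open_preimage) (auto intro: open_Times)
  moreover have "(x, y) \<in> ?P" using \<open>\<not> F (x, y) \<le> 0\<close> assms by auto
  ultimately obtain V W where VW: "open V" "open W" "x \<in> V" "y \<in> W" "V \<times> W \<subseteq> ?P"
    using open_prod_elim by (metis SigmaE2)
  obtain x' where x': "x' \<in> V" "x' \<notin> span (insert 0 L)"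
    using exists_generic_point[OF codim VW(1)] VW(3) by blast
  then have "x' \<notin> L" using span_base by blast
  obtain y' where y': "y' \<in> W" "y' \<notin> span (insert x' L)"
    using exists_generic_point[OF codim VW(2)] VW(4) by blast
  have "(x', y') \<in> ?P" using x' y' VW(5) by blast
  then show False using le[of x' y'] \<open>x' \<notin> L\<close> y' by auto
qed

text \<open>
  The Gronwall inequality along a segment: with \<open>p t\<close> running through the segment, the function
  \<open>|s (p t)|\<^sup>2 exp (-2 K t)\<close> has nonpositive derivative.
\<close>

lemma gronwall_segment:
  fixes s :: "'x::euclidean_space \<Rightarrow> 'f::euclidean_space"
  assumes "\<And>z. z \<in> closed_segment x y \<Longrightarrow> (s has_derivative s' z) (at z)"
    and "\<And>z. z \<in> closed_segment x y \<Longrightarrow> norm (s' z (y - x)) \<le> K * norm (s z)"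
  shows "norm (s y) \<le> exp K * norm (s x)"
proof -
  define p where "p t = x + t *\<^sub>R (y - x)" for t
  define h where "h t = (s (p t) \<bullet> s (p t)) * exp (- (2 * K * t))" for t
  have "h 1 \<le> h 0"
  proof (rule DERIV_nonpos_imp_nonincreasing[of 0 1 h])
    fix t :: real assume t: "0 \<le> t" "t \<le> 1"
    have p: "p t \<in> closed_segment x y"
      unfolding closed_segment_def p_def using t by (auto intro!: exI[of _ t] simp: algebra_simps)
    have "(p has_derivative (\<lambda>u. u *\<^sub>R (y - x))) (at t)"
      unfolding p_def by (auto intro!: derivative_eq_intros)
    from has_derivative_compose[OF this assms(1)[OF p]]
    have "((\<lambda>t. s (p t)) has_derivative (\<lambda>u. u *\<^sub>R s' (p t) (y - x))) (at t)"
      using has_derivative_linear[OF assms(1)[OF p]] by (simp add: linear_scale)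
    from has_derivative_inner[OF this this]
    have 1: "((\<lambda>t. s (p t) \<bullet> s (p t)) has_real_derivative 2 * (s (p t) \<bullet> s' (p t) (y - x))) (at t)"
      by (simp add: has_field_derivative_def inner_commute algebra_simps mult_commute_abs)
    have 2: "((\<lambda>t. exp (- (2 * K * t))) has_real_derivative - (2 * K) * exp (- (2 * K * t))) (at t)"
      by (auto intro!: derivative_eq_intros)
    let ?d = "2 * (s (p t) \<bullet> s' (p t) (y - x)) * exp (- (2 * K * t))
                + - (2 * K) * exp (- (2 * K * t)) * (s (p t) \<bullet> s (p t))"
    have "(h has_real_derivative ?d) (at t)"
      unfolding h_def using DERIV_mult[OF 1 2] .
    moreover have "?d \<le> 0"
    proof -
      have "s (p t) \<bullet> s' (p t) (y - x) \<le> norm (s (p t)) * norm (s' (p t) (y - x))"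
        by (rule norm_cauchy_schwarz)
      also have "\<dots> \<le> norm (s (p t)) * (K * norm (s (p t)))"
        using assms(2)[OF p] by (intro mult_left_mono) auto
      also have "\<dots> = K * (s (p t) \<bullet> s (p t))"
        by (simp add: dot_square_norm power2_eq_square)
      finally have "(s (p t) \<bullet> s' (p t) (y - x)) - K * (s (p t) \<bullet> s (p t)) \<le> 0" by simp
      then have "(2 * exp (- (2 * K * t))) * ((s (p t) \<bullet> s' (p t) (y - x)) - K * (s (p t) \<bullet> s (p t))) \<le> 0"
        by (intro mult_nonneg_nonpos) auto
      then show ?thesis by (simp add: algebra_simps)
    qed
    ultimately show "\<exists>d. (h has_real_derivative d) (at t) \<and> d \<le> 0" by blast
  qed simp
  then have "(norm (s y))\<^sup>2 * exp (- (2 * K)) \<le> (norm (s x))\<^sup>2"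
    by (simp add: h_def p_def power2_norm_eq_inner)
  then have "(norm (s y))\<^sup>2 \<le> exp (2 * K) * (norm (s x))\<^sup>2"
    by (simp add: exp_minus field_simps)
  then have "(norm (s y))\<^sup>2 \<le> (exp K * norm (s x))\<^sup>2"
    by (simp only: power_mult_distrib exp_double)
  then show ?thesis by (rule power2_le_imp_le) simp
qed

text \<open>
  Three estimates along generic segments, each carried over to all pairs of points by continuity: a Gronwall bound
  for \<open>s\<close>, a Lipschitz bound for \<open>s\<close>, and, once \<open>s\<close> is extended to \<open>\<tau>\<close>, the linear approximation
  of \<open>\<tau>\<close> by the right-hand side of the system. Boundedness must come first, since the system bounds the derivative of
  \<open>s\<close> only in terms of \<open>s\<close>. The coefficients live on a set containing the closed ball, which makes them bounded.
\<close>

theorem extend_solution_across_subspace: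
  fixes s :: "'x::euclidean_space \<Rightarrow> 'f::euclidean_space" and a :: "'x \<Rightarrow> 'f \<Rightarrow> 'x \<Rightarrow> 'f"
  assumes L: "subspace L" "dim L + 2 \<le> DIM('x)"
    and S: "open S" "S \<subseteq> ball c r" "ball c r - L \<subseteq> S"
    and s: "smooth_on S s"
    and a: "\<And>i b. i \<in> Basis \<Longrightarrow> b \<in> Basis \<Longrightarrow> smooth_on T (a i b)" "cball c r \<subseteq> T"
    and eq: "\<And>x i. x \<in> S \<Longrightarrow> i \<in> Basis \<Longrightarrow>
        frechet_derivative s (at x) i = (\<Sum>b\<in>Basis. (s x \<bullet> b) *\<^sub>R a i b x)"
  shows "\<exists>\<tau>. smooth_on (ball c r) \<tau> \<and> (\<forall>x\<in>S. \<tau> x = s x)"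
proof -
  define w where "w x u i = (\<Sum>b\<in>Basis. (u \<bullet> b) *\<^sub>R a i b x)" for x u i
  define H where "H x u v = (\<Sum>i\<in>Basis. (v \<bullet> i) *\<^sub>R w x u i)" for x u v
  \<comment> \<open>\<open>H x u\<close> is the derivative at \<open>x\<close> that the system prescribes for a solution with value \<open>u\<close> there. It
    is defined at points of \<open>L\<close> as well, which makes it the candidate for the derivative of the extension.\<close>
  have linH: "bounded_linear (H x u)" for x u
    unfolding H_def by (intro bounded_linear_intros)
  have ds: "(s has_derivative H x (s x)) (at x)" if "x \<in> S" for x
  proof -
    have d: "(s has_derivative frechet_derivative s (at x)) (at x)"
      by (rule smooth_on_differentiable[OF s that])
    have "frechet_derivative s (at x) = H x (s x)"
      using linear_componentwise_expansion[OF has_derivative_linear[OF d]] eq[OF that]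
      by (auto simp: H_def w_def)
    with d show ?thesis by simp
  qed

  have "\<exists>C. \<forall>x\<in>cball c r. norm (a i b x) \<le> C" if "i \<in> Basis" "b \<in> Basis" for i b
  proof -
    have "continuous_on (cball c r) (a i b)"
      using smooth_on_continuous_on[OF a(1)[OF that]] continuous_on_subset a(2) by blast
    then have "bounded (a i b ` cball c r)"
      by (intro compact_imp_bounded compact_continuous_image) auto
    then show ?thesis by (auto simp: bounded_iff)
  qed
  then obtain C where C: "\<And>i b x. i \<in> Basis \<Longrightarrow> b \<in> Basis \<Longrightarrow> x \<in> cball c r \<Longrightarrow> norm (a i b x) \<le> C i b"
    by metis
  define K where "K = (\<Sum>i\<in>(Basis::'x set). \<Sum>b\<in>(Basis::'f set). \<bar>C i b\<bar>)"
  have K0: "K \<ge> 0" unfolding K_def by (intro sum_nonneg) auto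
  have H_le: "norm (H x u v) \<le> K * norm u * norm v" if "x \<in> cball c r" for x u v
  proof -
    have "norm (H x u v) \<le> (\<Sum>i\<in>Basis. norm ((v \<bullet> i) *\<^sub>R w x u i))"
      unfolding H_def by (rule norm_sum)
    also have "\<dots> \<le> (\<Sum>i\<in>Basis. norm v * (\<Sum>b\<in>(Basis::'f set). norm u * \<bar>C i b\<bar>))"
    proof (rule sum_mono)
      fix i :: 'x assume i: "i \<in> Basis"
      have "norm (w x u i) \<le> (\<Sum>b\<in>Basis. norm ((u \<bullet> b) *\<^sub>R a i b x))"
        unfolding w_def by (rule norm_sum)
      also have "\<dots> \<le> (\<Sum>b\<in>Basis. norm u * \<bar>C i b\<bar>)"
      proof (rule sum_mono)
        fix b :: 'f assume b: "b \<in> Basis"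
        show "norm ((u \<bullet> b) *\<^sub>R a i b x) \<le> norm u * \<bar>C i b\<bar>"
          using Basis_le_norm[OF b, of u] C[OF i b that] by (auto intro!: mult_mono)
      qed
      finally have "norm (w x u i) \<le> (\<Sum>b\<in>Basis. norm u * \<bar>C i b\<bar>)" .
      then show "norm ((v \<bullet> i) *\<^sub>R w x u i) \<le> norm v * (\<Sum>b\<in>(Basis::'f set). norm u * \<bar>C i b\<bar>)"
        using Basis_le_norm[OF i, of v] by (auto intro!: mult_mono)
    qed
    also have "\<dots> = K * norm u * norm v"
      by (simp add: K_def sum_distrib_left sum_distrib_right mult_ac)
    finally show ?thesis .
  qed

  have seg: "z \<in> S" if "x \<in> S" "y \<in> S" "x \<notin> L" "y \<notin> span (insert x L)" "z \<in> closed_segment x y" for x y z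
  proof -
    have "closed_segment x y \<subseteq> ball c r"
      using that S(2) by (intro closed_segment_subset) auto
    then show ?thesis using generic_segment_avoids_subspace[OF L(1) that(3-5)] S(3) that(5) by blast
  qed
  have cs: "continuous_on S s" by (rule smooth_on_continuous_on[OF s])
  have growth: "norm (s y) - exp (K * (2 * r)) * norm (s x) \<le> 0" if "x \<in> S" "y \<in> S" for x y
  proof -
    have "(\<lambda>p. norm (s (snd p)) - exp (K * (2 * r)) * norm (s (fst p))) (x, y) \<le> 0"
    proof (rule le_of_le_generic_pairs[OF L(2) S(1) _ _ that])
      show "continuous_on (S \<times> S) (\<lambda>p. norm (s (snd p)) - exp (K * (2 * r)) * norm (s (fst p)))"
        by (intro continuous_intros continuous_on_compose2[OF cs]) auto
      fix x y assume xy: "x \<in> S" "y \<in> S" "x \<notin> L" "y \<notin> span (insert x L)"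
      have "norm (s y) \<le> exp (K * (2 * r)) * norm (s x)"
      proof (rule gronwall_segment[of x y s "\<lambda>z. H z (s z)"])
        fix z assume z: "z \<in> closed_segment x y"
        note zS = seg[OF xy z]
        show "(s has_derivative H z (s z)) (at z)" using ds[OF zS] .
        have "dist x y \<le> dist c x + dist c y" by metric
        moreover have "dist c x < r" "dist c y < r" using xy(1,2) S(2) by auto
        ultimately have "norm (y - x) \<le> 2 * r" by (simp add: dist_norm norm_minus_commute)
        moreover have "norm (H z (s z) (y - x)) \<le> K * norm (s z) * norm (y - x)"
          using zS S(2) by (intro H_le) auto
        ultimately have "norm (H z (s z) (y - x)) \<le> K * norm (s z) * (2 * r)"
          using K0 by (meson mult_left_mono mult_nonneg_nonneg norm_ge_zero order_trans)
        then show "norm (H z (s z) (y - x)) \<le> K * (2 * r) * norm (s z)" by (simp add: mult_ac)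
      qed
      then show "norm (s (snd (x, y))) - exp (K * (2 * r)) * norm (s (fst (x, y))) \<le> 0" by simp
    qed
    then show ?thesis by simp
  qed
  have "\<exists>M. \<forall>y\<in>S. norm (s y) \<le> M"
  proof (cases "S = {}")
    case False
    then obtain x where "x \<in> S" by auto
    then show ?thesis using growth[of x] by (intro exI[of _ "exp (K * (2 * r)) * norm (s x)"]) auto
  qed auto
  then obtain M where M: "\<And>y. y \<in> S \<Longrightarrow> norm (s y) \<le> M" by auto

  have lip: "norm (s y - s x) - K * \<bar>M\<bar> * norm (y - x) \<le> 0" if "x \<in> S" "y \<in> S" for x y
  proof -
    have "(\<lambda>p. norm (s (snd p) - s (fst p)) - K * \<bar>M\<bar> * norm (snd p - fst p)) (x, y) \<le> 0"
    proof (rule le_of_le_generic_pairs[OF L(2) S(1) _ _ that])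
      show "continuous_on (S \<times> S) (\<lambda>p. norm (s (snd p) - s (fst p)) - K * \<bar>M\<bar> * norm (snd p - fst p))"
        by (intro continuous_intros continuous_on_compose2[OF cs]) auto
      fix x y assume xy: "x \<in> S" "y \<in> S" "x \<notin> L" "y \<notin> span (insert x L)"
      have "norm (s y - s x) \<le> K * \<bar>M\<bar> * norm (y - x)"
      proof (rule differentiable_bound[of "closed_segment x y" s "\<lambda>z. H z (s z)"])
        fix z assume z: "z \<in> closed_segment x y"
        note zS = seg[OF xy z]
        show "(s has_derivative H z (s z)) (at z within closed_segment x y)"
          using ds[OF zS] has_derivative_at_withinI by blast
        show "onorm (H z (s z)) \<le> K * \<bar>M\<bar>"
        proof (rule onorm_le)
          fix v
          have "norm (H z (s z) v) \<le> K * norm (s z) * norm v" using zS S(2) by (intro H_le) auto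
          also have "\<dots> \<le> K * \<bar>M\<bar> * norm v"
            using M[OF zS] K0 by (intro mult_right_mono mult_left_mono) auto
          finally show "norm (H z (s z) v) \<le> K * \<bar>M\<bar> * norm v" .
        qed
      qed auto
      then show "norm (s (snd (x, y)) - s (fst (x, y))) - K * \<bar>M\<bar> * norm (snd (x, y) - fst (x, y)) \<le> 0" by simp
    qed
    then show ?thesis by simp
  qed
  have "(K * \<bar>M\<bar>)-lipschitz_on S s"
    by (rule lipschitz_onI) (use lip K0 in \<open>auto simp: dist_norm norm_minus_commute\<close>)
  then have "uniformly_continuous_on S s" by (rule lipschitz_on_uniformly_continuous)
  then obtain \<tau> where \<tau>: "uniformly_continuous_on (closure S) \<tau>" "\<And>x. x \<in> S \<Longrightarrow> s x = \<tau> x"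
    by (rule uniformly_continuous_on_extension_on_closure) blast
  have "ball c r \<subseteq> closure S"
  proof
    fix x assume x: "x \<in> ball c r"
    show "x \<in> closure S"
      unfolding closure_iff_nhds_not_empty
    proof (intro allI impI)
      fix A V assume V: "V \<subseteq> A" "open V" "x \<in> V"
      obtain y where "y \<in> V \<inter> ball c r" "y \<notin> span (insert 0 L)"
        using exists_generic_point[OF L(2), of "V \<inter> ball c r"] V x by blast
      then have "y \<in> S \<inter> A" using S(3) V span_base[of y "insert 0 L"] by blast
      then show "S \<inter> A \<noteq> {}" by blast
    qed
  qed
  then have ct: "continuous_on (ball c r) \<tau>"
    using \<tau>(1) uniformly_continuous_imp_continuous continuous_on_subset by blast

  have dt: "(\<tau> has_derivative H z (\<tau> z)) (at z)" if z: "z \<in> ball c r" for z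
    unfolding has_derivative_at_alt
  proof (intro conjI allI impI linH)
    fix e :: real assume e: "e > 0"
    let ?m = "\<lambda>x. \<Sum>i\<in>Basis. norm (w x (\<tau> x) i - w z (\<tau> z) i)"
    have ca: "continuous_on (ball c r) (a i b)" if "i \<in> Basis" "b \<in> Basis" for i b
      using smooth_on_continuous_on[OF a(1)[OF that]] a(2) ball_subset_cball
      by (meson continuous_on_subset subset_trans)
    have "continuous_on (ball c r) ?m"
      unfolding w_def by (intro continuous_intros ct ca)
    then have "open (ball c r \<inter> ?m -` {..<e})"
      by (intro continuous_open_preimage) auto
    moreover have "z \<in> ball c r \<inter> ?m -` {..<e}" using z e by simp
    ultimately obtain d where d: "d > 0" "ball z d \<subseteq> ball c r \<inter> ?m -` {..<e}"
      using open_contains_ball_eq by blast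
    \<comment> \<open>This is needed for \<open>x = z\<close> only, but the case that \<open>z\<close> lies in \<open>L\<close> is reached only as a limit of generic \<open>x\<close>.\<close>
    have near: "norm (\<tau> y - \<tau> x - H z (\<tau> z) (y - x)) - e * norm (y - x) \<le> 0"
      if "x \<in> ball z d" "y \<in> ball z d" for x y
    proof -
      have "(\<lambda>p. norm (\<tau> (snd p) - \<tau> (fst p) - H z (\<tau> z) (snd p - fst p)) - e * norm (snd p - fst p)) (x, y) \<le> 0"
      proof (rule le_of_le_generic_pairs[OF L(2) open_ball _ _ that])
        have ctz: "continuous_on (ball z d) \<tau>" using ct d(2) continuous_on_subset by blast
        show "continuous_on (ball z d \<times> ball z d)
           (\<lambda>p. norm (\<tau> (snd p) - \<tau> (fst p) - H z (\<tau> z) (snd p - fst p)) - e * norm (snd p - fst p))"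
          by (intro continuous_intros bounded_linear.continuous_on[OF linH]
                continuous_on_compose2[OF ctz]) auto
        fix x y assume xy: "x \<in> ball z d" "y \<in> ball z d" "x \<notin> L" "y \<notin> span (insert x L)"
        have "norm ((\<tau> y - H z (\<tau> z) y) - (\<tau> x - H z (\<tau> z) x)) \<le> e * norm (y - x)"
        proof (rule differentiable_bound[of "closed_segment x y" "\<lambda>p. \<tau> p - H z (\<tau> z) p"
              "\<lambda>p v. H p (\<tau> p) v - H z (\<tau> z) v"])
          fix p assume p: "p \<in> closed_segment x y"
          have pb: "p \<in> ball z d" using closed_segment_subset[OF xy(1,2)] p by auto
          have pS: "p \<in> S"
            using generic_segment_avoids_subspace[OF L(1) xy(3,4) p] pb d(2) S(3) by blast
          have "(\<tau> has_derivative H p (\<tau> p)) (at p)"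
            by (rule has_derivative_transform_within_open[OF _ S(1) pS \<tau>(2)])
               (use ds[OF pS] \<tau>(2)[OF pS] in auto)
          from has_derivative_diff[OF this bounded_linear_imp_has_derivative[OF linH]]
          show "((\<lambda>p. \<tau> p - H z (\<tau> z) p) has_derivative (\<lambda>v. H p (\<tau> p) v - H z (\<tau> z) v))
              (at p within closed_segment x y)"
            by (rule has_derivative_at_withinI)
          show "onorm (\<lambda>v. H p (\<tau> p) v - H z (\<tau> z) v) \<le> e"
          proof (rule onorm_le)
            fix v
            have "H p (\<tau> p) v - H z (\<tau> z) v = (\<Sum>i\<in>Basis. (v \<bullet> i) *\<^sub>R (w p (\<tau> p) i - w z (\<tau> z) i))"
              by (simp add: H_def sum_subtractf scaleR_diff_right)
            also have "norm \<dots> \<le> (\<Sum>i\<in>Basis. norm ((v \<bullet> i) *\<^sub>R (w p (\<tau> p) i - w z (\<tau> z) i)))"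
              by (rule norm_sum)
            also have "\<dots> \<le> (\<Sum>i\<in>Basis. norm v * norm (w p (\<tau> p) i - w z (\<tau> z) i))"
              by (rule sum_mono) (auto intro!: mult_right_mono Basis_le_norm)
            also have "\<dots> = ?m p * norm v" by (simp add: sum_distrib_left mult.commute)
            also have "\<dots> \<le> e * norm v"
              using pb d(2) by (intro mult_right_mono) (auto simp: less_imp_le)
            finally show "norm (H p (\<tau> p) v - H z (\<tau> z) v) \<le> e * norm v" .
          qed
        qed auto
        moreover have "(\<tau> y - H z (\<tau> z) y) - (\<tau> x - H z (\<tau> z) x) = \<tau> y - \<tau> x - H z (\<tau> z) (y - x)"
          using linear_diff[OF bounded_linear.linear[OF linH]] by simp
        ultimately show "norm (\<tau> (snd (x, y)) - \<tau> (fst (x, y)) - H z (\<tau> z) (snd (x, y) - fst (x, y)))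
            - e * norm (snd (x, y) - fst (x, y)) \<le> 0" by simp
      qed
      then show ?thesis by simp
    qed
    show "\<exists>d>0. \<forall>y. norm (y - z) < d \<longrightarrow> norm (\<tau> y - \<tau> z - H z (\<tau> z) (y - z)) \<le> e * norm (y - z)"
    proof (intro exI[of _ d] conjI allI impI d(1))
      fix y assume "norm (y - z) < d"
      then show "norm (\<tau> y - \<tau> z - H z (\<tau> z) (y - z)) \<le> e * norm (y - z)"
        using near[of z y] d(1) by (auto simp: dist_norm norm_minus_commute)
    qed
  qed

  \<comment> \<open>Bootstrapping: the derivative of \<open>\<tau>\<close> is a polynomial in \<open>\<tau>\<close> and the coefficients.\<close>
  have "Ck_on k (ball c r) \<tau>" for k
  proof (induction k)
    case 0
    then show ?case using ct by simp
  next
    case (Suc k)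
    show ?case
    proof (rule Ck_on_SucI[OF open_ball dt])
      have ca: "Ck_on k (ball c r) (a i b)" if "i \<in> Basis" "b \<in> Basis" for i b
        using a(1)[OF that] Ck_on_subset a(2) ball_subset_cball unfolding smooth_on_def by (metis subset_trans)
      show "Ck_on k (ball c r) (\<lambda>x. H x (\<tau> x) v)" for v
        unfolding H_def w_def
        by (intro Ck_on_sum Ck_on_bilinear[OF bounded_bilinear_scaleR] Ck_on_bilinear[OF bounded_bilinear_inner]
              Ck_on_const Suc ca open_ball)
    qed
  qed
  then show ?thesis using \<tau>(2) by (intro exI[of _ \<tau>]) (auto simp: smooth_on_def)
qed

section \<open>Smooth maps between manifolds\<close>

lemma is_chart_simps:
  assumes "is_chart (V, \<phi>)"
  shows "open V" "open (\<phi> ` V)" "homeomorphism V (\<phi> ` V) \<phi> (inv_into V \<phi>)"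
    and "continuous_on V \<phi>" "continuous_on (\<phi> ` V) (inv_into V \<phi>)" "inj_on \<phi> V"
    and "\<And>p. p \<in> V \<Longrightarrow> inv_into V \<phi> (\<phi> p) = p"
  using assms by (auto simp: is_chart_def homeomorphism_def inj_on_def) metis

lemma chart_image_open:
  assumes "is_chart (V, \<phi>)" "open G" "G \<subseteq> V" shows "open (\<phi> ` G)"
proof -
  have "openin (top_of_set V) G" using assms(2,3) by (simp add: openin_open_eq is_chart_simps(1)[OF assms(1)])
  from homeomorphism_imp_open_map[OF is_chart_simps(3)[OF assms(1)] this]
  show ?thesis using is_chart_simps(2)[OF assms(1)] by (simp add: openin_open_eq)
qed

text \<open>
  An atlas without compatibility of its charts. This is what locality and composition of smooth maps need, as
  \<open>smooth_map\<close> quantifies over all pairs of charts anyway, and it is quickly checked for products.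
\<close>

definition charts_cover :: "('m::topological_space, 'x::euclidean_space) chart set \<Rightarrow> bool" where
  "charts_cover A \<longleftrightarrow> (\<forall>c\<in>A. is_chart c) \<and> (\<Union>c\<in>A. fst c) = UNIV"

lemma charts_coverE:
  assumes "charts_cover A" obtains V \<phi> where "(V, \<phi>) \<in> A" "p \<in> V" "is_chart (V, \<phi>)"
proof -
  have "p \<in> (\<Union>c\<in>A. fst c)" using assms by (simp add: charts_cover_def)
  then obtain c where "c \<in> A" "p \<in> fst c" by blast
  then show ?thesis using that[of "fst c" "snd c"] assms by (auto simp: charts_cover_def)
qed

lemma charts_coverD: "charts_cover A \<Longrightarrow> (V, \<phi>) \<in> A \<Longrightarrow> is_chart (V, \<phi>)"
  by (auto simp: charts_cover_def)

lemma smooth_atlas_charts_cover: "smooth_atlas A \<Longrightarrow> charts_cover A"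
  by (simp add: smooth_atlas_def charts_cover_def)

lemma charts_cover_euclidean_atlas: "charts_cover euclidean_atlas"
  by (auto simp: charts_cover_def euclidean_atlas_def is_chart_def homeomorphism_def id_def)

lemma inv_into_map_prod:
  assumes "inj_on \<phi> V" "inj_on \<psi> W" "a \<in> \<phi> ` V" "b \<in> \<psi> ` W"
  shows "inv_into (V \<times> W) (map_prod \<phi> \<psi>) (a, b) = (inv_into V \<phi> a, inv_into W \<psi> b)"
  by (rule inv_into_f_eq) (use assms in \<open>auto simp: map_prod_inj_on inv_into_into f_inv_into_f\<close>)

lemma is_chart_map_prod:
  assumes "is_chart (V, \<phi>)" "is_chart (W, \<psi>)"
  shows "is_chart (V \<times> W, map_prod \<phi> \<psi>)"
proof -
  note a = is_chart_simps[OF assms(1)] and b = is_chart_simps[OF assms(2)]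
  have im: "map_prod \<phi> \<psi> ` (V \<times> W) = \<phi> ` V \<times> \<psi> ` W" by auto
  have "continuous_on (\<phi> ` V \<times> \<psi> ` W) (\<lambda>p. (inv_into V \<phi> (fst p), inv_into W \<psi> (snd p)))"
    by (intro continuous_intros continuous_on_compose2[OF a(5)] continuous_on_compose2[OF b(5)]) auto
  then have ci: "continuous_on (\<phi> ` V \<times> \<psi> ` W) (inv_into (V \<times> W) (map_prod \<phi> \<psi>))"
    by (rule continuous_on_eq) (use a b in \<open>auto simp: inv_into_map_prod\<close>)
  have c: "continuous_on (V \<times> W) (map_prod \<phi> \<psi>)"
    unfolding map_prod_def case_prod_unfold
    by (intro continuous_intros continuous_on_compose2[OF a(4)] continuous_on_compose2[OF b(4)]) auto
  have "homeomorphism (V \<times> W) (\<phi> ` V \<times> \<psi> ` W) (map_prod \<phi> \<psi>) (inv_into (V \<times> W) (map_prod \<phi> \<psi>))"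
    by (rule homeomorphismI[OF c ci]) (use a b in \<open>auto simp: inv_into_map_prod\<close>)
  then show ?thesis
    unfolding is_chart_def prod.case im using a b by (simp add: open_Times)
qed

lemma charts_cover_prod_atlas:
  assumes "charts_cover A" "charts_cover B" shows "charts_cover (prod_atlas A B)"
  unfolding charts_cover_def
proof (intro conjI)
  show "\<forall>c\<in>prod_atlas A B. is_chart c"
    using charts_coverD[OF assms(1)] charts_coverD[OF assms(2)]
    by (auto simp: prod_atlas_def intro!: is_chart_map_prod)
  show "(\<Union>c\<in>prod_atlas A B. fst c) = UNIV"
  proof safe
    fix p q
    obtain V \<phi> where "(V, \<phi>) \<in> A" "p \<in> V" by (rule charts_coverE[OF assms(1)])
    moreover obtain W \<psi> where "(W, \<psi>) \<in> B" "q \<in> W" by (rule charts_coverE[OF assms(2)])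
    ultimately have "(V \<times> W, map_prod \<phi> \<psi>) \<in> prod_atlas A B"
      unfolding prod_atlas_def by blast
    then show "(p, q) \<in> (\<Union>c\<in>prod_atlas A B. fst c)"
      by (rule UN_I) (simp add: \<open>p \<in> V\<close> \<open>q \<in> W\<close>)
  qed auto
qed

lemma smooth_mapD:
  assumes "smooth_map A B W f"
  shows "continuous_on W f"
    and "(V, \<phi>) \<in> A \<Longrightarrow> (V', \<psi>) \<in> B \<Longrightarrow>
      smooth_on (\<phi> ` (V \<inter> W \<inter> f -` V')) (\<psi> \<circ> f \<circ> inv_into V \<phi>)"
  using assms by (auto simp: smooth_map_def)

lemma smooth_mapI:
  assumes "continuous_on W f"
    and "\<And>V \<phi> V' \<psi>. (V, \<phi>) \<in> A \<Longrightarrow> (V', \<psi>) \<in> B \<Longrightarrow>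
      smooth_on (\<phi> ` (V \<inter> W \<inter> f -` V')) (\<psi> \<circ> f \<circ> inv_into V \<phi>)"
  shows "smooth_map A B W f"
  using assms by (auto simp: smooth_map_def)

lemma smooth_map_subset:
  assumes "smooth_map A B W f" "W' \<subseteq> W" shows "smooth_map A B W' f"
proof (rule smooth_mapI)
  show "continuous_on W' f" using smooth_mapD(1)[OF assms(1)] assms(2) by (rule continuous_on_subset)
  fix V \<phi> V' \<psi> assume "(V, \<phi>) \<in> A" "(V', \<psi>) \<in> B"
  then show "smooth_on (\<phi> ` (V \<inter> W' \<inter> f -` V')) (\<psi> \<circ> f \<circ> inv_into V \<phi>)"
    using assms(2) by (intro smooth_on_subset[OF smooth_mapD(2)[OF assms(1)]]) auto
qed

lemma smooth_map_domain_open: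
  assumes "charts_cover A" "charts_cover B" "continuous_on W f" "open W" "(V, \<phi>) \<in> A" "(V', \<psi>) \<in> B"
  shows "open (V \<inter> W \<inter> f -` V')" "open (\<phi> ` (V \<inter> W \<inter> f -` V'))"
proof -
  have "open (W \<inter> f -` V')"
    using assms charts_coverD is_chart_simps(1) by (intro continuous_open_preimage) blast+
  then show "open (V \<inter> W \<inter> f -` V')"
    using is_chart_simps(1)[OF charts_coverD[OF assms(1,5)]] by (simp add: Int_assoc open_Int)
  then show "open (\<phi> ` (V \<inter> W \<inter> f -` V'))"
    by (rule chart_image_open[OF charts_coverD[OF assms(1,5)]]) auto
qed

lemma smooth_map_cong:
  assumes "charts_cover A" "charts_cover B" "open W" "\<And>p. p \<in> W \<Longrightarrow> f p = g p" "smooth_map A B W f"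
  shows "smooth_map A B W g"
proof (rule smooth_mapI)
  show "continuous_on W g" using smooth_mapD(1)[OF assms(5)] assms(4) by (simp cong: continuous_on_cong)
  fix V \<phi> V' \<psi> assume c: "(V, \<phi>) \<in> A" "(V', \<psi>) \<in> B"
  have "smooth_on (\<phi> ` (V \<inter> W \<inter> f -` V')) (\<psi> \<circ> g \<circ> inv_into V \<phi>)"
  proof (rule smooth_on_cong[OF _ _ smooth_mapD(2)[OF assms(5) c]])
    show "open (\<phi> ` (V \<inter> W \<inter> f -` V'))"
      by (rule smooth_map_domain_open(2)[OF assms(1,2) smooth_mapD(1)[OF assms(5)] assms(3) c])
  qed (use assms(4) is_chart_simps(7)[OF charts_coverD[OF assms(1) c(1)]] in auto)
  moreover have "V \<inter> W \<inter> f -` V' = V \<inter> W \<inter> g -` V'" using assms(4) by auto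
  ultimately show "smooth_on (\<phi> ` (V \<inter> W \<inter> g -` V')) (\<psi> \<circ> g \<circ> inv_into V \<phi>)" by simp
qed

lemma continuous_on_local:
  assumes "\<And>p. p \<in> W \<Longrightarrow> \<exists>G. open G \<and> p \<in> G \<and> continuous_on G f"
  shows "continuous_on W f"
proof -
  obtain G where G: "\<And>p. p \<in> W \<Longrightarrow> open (G p) \<and> p \<in> G p \<and> continuous_on (G p) f"
    using assms by metis
  then have "continuous_on (\<Union>p\<in>W. G p) f" by (intro continuous_on_open_UN) auto
  then show ?thesis using G by (auto elim!: continuous_on_subset)
qed

lemma smooth_map_local:
  assumes "charts_cover A" "charts_cover B"
    and loc: "\<And>p. p \<in> W \<Longrightarrow> \<exists>G. open G \<and> p \<in> G \<and> smooth_map A B G f"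
  shows "smooth_map A B W f"
proof (rule smooth_mapI)
  show "continuous_on W f"
  proof (rule continuous_on_local)
    fix p assume "p \<in> W"
    then obtain G where G: "open G" "p \<in> G" "smooth_map A B G f" using loc by auto
    show "\<exists>G. open G \<and> p \<in> G \<and> continuous_on G f"
      using G(1,2) smooth_mapD(1)[OF G(3)] by blast
  qed
  fix V \<phi> V' \<psi> assume c: "(V, \<phi>) \<in> A" "(V', \<psi>) \<in> B"
  show "smooth_on (\<phi> ` (V \<inter> W \<inter> f -` V')) (\<psi> \<circ> f \<circ> inv_into V \<phi>)"
  proof (rule smooth_on_open_cover)
    fix x assume "x \<in> \<phi> ` (V \<inter> W \<inter> f -` V')"
    then obtain p where p: "x = \<phi> p" "p \<in> V" "p \<in> W" "f p \<in> V'" by auto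
    obtain G where G: "open G" "p \<in> G" "smooth_map A B G f" using loc[OF p(3)] by auto
    show "\<exists>T. open T \<and> x \<in> T \<and> smooth_on T (\<psi> \<circ> f \<circ> inv_into V \<phi>)"
      using smooth_map_domain_open(2)[OF assms(1,2) smooth_mapD(1)[OF G(3)] G(1) c] smooth_mapD(2)[OF G(3) c] p G(2)
      by (intro exI[of _ "\<phi> ` (V \<inter> G \<inter> f -` V')"]) auto
  qed
qed

text \<open>
  A chart of the middle manifold around \<open>f p\<close> reduces the claim near \<open>p\<close> to the Euclidean chain rule.
\<close>

lemma smooth_map_compose:
  assumes cov: "charts_cover A" "charts_cover B" "charts_cover C"
    and op: "open W" "open W'"
    and f: "smooth_map A B W f" and g: "smooth_map B C W' g" and sub: "f ` W \<subseteq> W'"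
  shows "smooth_map A C W (\<lambda>p. g (f p))"
proof (rule smooth_mapI)
  note cf = smooth_mapD(1)[OF f] and cg = smooth_mapD(1)[OF g]
  show c: "continuous_on W (\<lambda>p. g (f p))"
    by (rule continuous_on_compose2[OF cg cf sub])
  fix V \<phi> V' \<psi> assume ch: "(V, \<phi>) \<in> A" "(V', \<psi>) \<in> C"
  let ?R = "V \<inter> W \<inter> (\<lambda>p. g (f p)) -` V'"
  show "smooth_on (\<phi> ` ?R) (\<psi> \<circ> (\<lambda>p. g (f p)) \<circ> inv_into V \<phi>)"
  proof (rule smooth_on_open_cover)
    fix x assume "x \<in> \<phi> ` ?R"
    then obtain p where p: "x = \<phi> p" "p \<in> ?R" by auto
    obtain Q \<rho> where Q: "(Q, \<rho>) \<in> B" "f p \<in> Q" "is_chart (Q, \<rho>)"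
      by (rule charts_coverE[OF cov(2)])
    let ?G = "?R \<inter> (V \<inter> W \<inter> f -` Q)"
    have oG: "open (\<phi> ` ?G)"
      using smooth_map_domain_open(1)[OF cov(1,3) c op(1) ch] smooth_map_domain_open(1)[OF cov(1,2) cf op(1) ch(1) Q(1)]
      by (intro chart_image_open[OF charts_coverD[OF cov(1) ch(1)]]) auto
    have inv: "inv_into V \<phi> (\<phi> q) = q" if "q \<in> V" for q
      using is_chart_simps(7)[OF charts_coverD[OF cov(1) ch(1)] that] .
    have "smooth_on (\<phi> ` ?G) (\<lambda>x. (\<psi> \<circ> g \<circ> inv_into Q \<rho>) ((\<rho> \<circ> f \<circ> inv_into V \<phi>) x))"
    proof (rule smooth_on_compose[OF oG smooth_map_domain_open(2)[OF cov(2,3) cg op(2) Q(1) ch(2)]])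
      show "(\<rho> \<circ> f \<circ> inv_into V \<phi>) ` \<phi> ` ?G \<subseteq> \<rho> ` (Q \<inter> W' \<inter> g -` V')"
        using sub by (auto simp: inv)
      show "smooth_on (\<phi> ` ?G) (\<rho> \<circ> f \<circ> inv_into V \<phi>)"
        by (rule smooth_on_subset[OF smooth_mapD(2)[OF f ch(1) Q(1)]]) auto
      show "smooth_on (\<rho> ` (Q \<inter> W' \<inter> g -` V')) (\<psi> \<circ> g \<circ> inv_into Q \<rho>)"
        by (rule smooth_mapD(2)[OF g Q(1) ch(2)])
    qed
    then have "smooth_on (\<phi> ` ?G) (\<psi> \<circ> (\<lambda>p. g (f p)) \<circ> inv_into V \<phi>)"
      by (rule smooth_on_cong[OF oG, rotated]) (auto simp: inv is_chart_simps(7)[OF Q(3)])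
    then show "\<exists>T. open T \<and> x \<in> T \<and> smooth_on T (\<psi> \<circ> (\<lambda>p. g (f p)) \<circ> inv_into V \<phi>)"
      using oG p Q(2) by (intro exI[of _ "\<phi> ` ?G"]) auto
  qed
qed

lemma smooth_map_id:
  assumes "smooth_atlas A" shows "smooth_map A A W (\<lambda>p. p)"
proof (rule smooth_mapI)
  fix V \<phi> V' \<psi> assume "(V, \<phi>) \<in> A" "(V', \<psi>) \<in> A"
  then have "smooth_on (\<phi> ` (V \<inter> V')) (\<psi> \<circ> inv_into V \<phi>)"
    using assms by (auto simp: smooth_atlas_def compatible_def)
  then have "smooth_on (\<phi> ` (V \<inter> W \<inter> V')) (\<psi> \<circ> inv_into V \<phi>)"
    by (rule smooth_on_subset) auto
  then show "smooth_on (\<phi> ` (V \<inter> W \<inter> (\<lambda>p. p) -` V')) (\<psi> \<circ> (\<lambda>p. p) \<circ> inv_into V \<phi>)"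
    by (simp add: comp_def)
qed simp

lemma smooth_map_to_euclidean_iff:
  assumes "charts_cover A" "open W"
  shows "smooth_map A euclidean_atlas W f \<longleftrightarrow>
    (\<forall>V \<phi>. (V, \<phi>) \<in> A \<longrightarrow> smooth_on (\<phi> ` (V \<inter> W)) (\<lambda>x. f (inv_into V \<phi> x)))"
proof
  assume "smooth_map A euclidean_atlas W f"
  from smooth_mapD(2)[OF this, of _ _ UNIV id]
  show "\<forall>V \<phi>. (V, \<phi>) \<in> A \<longrightarrow> smooth_on (\<phi> ` (V \<inter> W)) (\<lambda>x. f (inv_into V \<phi> x))"
    by (simp add: euclidean_atlas_def comp_def)
next
  assume *: "\<forall>V \<phi>. (V, \<phi>) \<in> A \<longrightarrow> smooth_on (\<phi> ` (V \<inter> W)) (\<lambda>x. f (inv_into V \<phi> x))"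
  show "smooth_map A euclidean_atlas W f"
  proof (rule smooth_mapI)
    have "\<exists>G. open G \<and> p \<in> G \<and> continuous_on G f" if "p \<in> W" for p
    proof -
      obtain V \<phi> where V: "(V, \<phi>) \<in> A" "p \<in> V" "is_chart (V, \<phi>)" by (rule charts_coverE[OF assms(1)])
      have c: "continuous_on (V \<inter> W) \<phi>" using is_chart_simps(4)[OF V(3)] continuous_on_subset by blast
      have "continuous_on (V \<inter> W) (\<lambda>q. f (inv_into V \<phi> (\<phi> q)))"
        by (rule continuous_on_compose2[OF smooth_on_continuous_on[OF *[rule_format, OF V(1)]] c]) simp
      then have "continuous_on (V \<inter> W) f"
        by (rule continuous_on_eq) (simp add: is_chart_simps(7)[OF V(3)])
      then show ?thesis
        using assms(2) is_chart_simps(1)[OF V(3)] V(2) that by (intro exI[of _ "V \<inter> W"]) (auto simp: open_Int)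
    qed
    then show "continuous_on W f" by (rule continuous_on_local)
  qed (use * in \<open>simp add: euclidean_atlas_def comp_def\<close>)
qed

lemma smooth_map_euclidean_iff:
  assumes "open W"
  shows "smooth_map euclidean_atlas euclidean_atlas W f \<longleftrightarrow> smooth_on W f"
  using smooth_on_continuous_on[of W f]
  by (auto simp: smooth_map_def euclidean_atlas_def inv_into_def id_def comp_def)

lemma smooth_map_chart:
  assumes "smooth_atlas A" "(V, \<phi>) \<in> A" shows "smooth_map A euclidean_atlas V \<phi>"
proof -
  note cov = smooth_atlas_charts_cover[OF assms(1)]
  show ?thesis
    using assms is_chart_simps(1)[OF charts_coverD[OF cov assms(2)]]
    by (auto simp: smooth_map_to_euclidean_iff[OF cov] smooth_atlas_def compatible_def comp_def)
qed

lemma smooth_map_Pair: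
  assumes cov: "charts_cover A" "charts_cover B" "charts_cover C" and op: "open W"
    and f: "smooth_map A B W f" and g: "smooth_map A C W g"
  shows "smooth_map A (prod_atlas B C) W (\<lambda>p. (f p, g p))"
proof (rule smooth_mapI)
  show c: "continuous_on W (\<lambda>p. (f p, g p))"
    using smooth_mapD(1)[OF f] smooth_mapD(1)[OF g] by (rule continuous_on_Pair)
  fix V \<phi> V' \<psi> assume ch: "(V, \<phi>) \<in> A" "(V', \<psi>) \<in> prod_atlas B C"
  from ch(2) obtain P \<alpha> Q \<beta> where PQ: "V' = P \<times> Q" "\<psi> = map_prod \<alpha> \<beta>" "(P, \<alpha>) \<in> B" "(Q, \<beta>) \<in> C"
    by (auto simp: prod_atlas_def)
  let ?S = "\<phi> ` (V \<inter> W \<inter> (\<lambda>p. (f p, g p)) -` V')"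
  have "open ?S" using smooth_map_domain_open(2)[OF cov(1) charts_cover_prod_atlas[OF cov(2,3)] c op ch] .
  moreover have "smooth_on ?S (\<alpha> \<circ> f \<circ> inv_into V \<phi>)"
    by (rule smooth_on_subset[OF smooth_mapD(2)[OF f ch(1) PQ(3)]]) (auto simp: PQ)
  moreover have "smooth_on ?S (\<beta> \<circ> g \<circ> inv_into V \<phi>)"
    by (rule smooth_on_subset[OF smooth_mapD(2)[OF g ch(1) PQ(4)]]) (auto simp: PQ)
  ultimately have "smooth_on ?S (\<lambda>x. ((\<alpha> \<circ> f \<circ> inv_into V \<phi>) x, (\<beta> \<circ> g \<circ> inv_into V \<phi>) x))"
    by (rule smooth_on_Pair)
  then show "smooth_on ?S (\<psi> \<circ> (\<lambda>p. (f p, g p)) \<circ> inv_into V \<phi>)"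
    by (simp add: PQ comp_def)
qed

lemma smooth_map_snd:
  assumes "charts_cover A"
  shows "smooth_map (prod_atlas A (euclidean_atlas :: ('f::euclidean_space, 'f) chart set)) euclidean_atlas UNIV snd"
proof -
  note cov = charts_cover_prod_atlas[OF assms charts_cover_euclidean_atlas]
  show ?thesis
    unfolding smooth_map_to_euclidean_iff[OF cov open_UNIV]
  proof (intro allI impI)
    fix V \<phi> assume c: "(V, \<phi>) \<in> prod_atlas A (euclidean_atlas :: ('f, 'f) chart set)"
    then obtain P \<alpha> where P: "V = P \<times> UNIV" "\<phi> = map_prod \<alpha> id" "(P, \<alpha>) \<in> A"
      by (auto simp: prod_atlas_def euclidean_atlas_def)
    note ch = is_chart_simps[OF charts_coverD[OF cov c]]
    have "smooth_on (\<phi> ` V) (\<lambda>x. snd (inv_into V \<phi> x))"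
      by (rule smooth_on_cong[OF ch(2) _ smooth_on_bounded_linear[OF bounded_linear_snd ch(2)]])
         (auto simp: ch(7), auto simp: P)
    then show "smooth_on (\<phi> ` (V \<inter> UNIV)) (\<lambda>x. snd (inv_into V \<phi> x))" by simp
  qed
qed

lemma smooth_map_const_euclidean:
  "charts_cover A \<Longrightarrow> open W \<Longrightarrow> smooth_map A euclidean_atlas W (\<lambda>p. c)"
  by (simp add: smooth_map_to_euclidean_iff smooth_on_const)

lemma chart_image_Int_open:
  assumes "charts_cover A" "open W" "(V, \<phi>) \<in> A" shows "open (\<phi> ` (V \<inter> W))"
  using chart_image_open[OF charts_coverD[OF assms(1,3)], of "V \<inter> W"]
    is_chart_simps(1)[OF charts_coverD[OF assms(1,3)]] assms(2) by (simp add: open_Int)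

lemma smooth_map_add:
  assumes "charts_cover A" "open W" "smooth_map A euclidean_atlas W f" "smooth_map A euclidean_atlas W g"
  shows "smooth_map A euclidean_atlas W (\<lambda>p. f p + g p)"
  using assms(3,4) unfolding smooth_map_to_euclidean_iff[OF assms(1,2)]
  by (auto intro!: smooth_on_add chart_image_Int_open[OF assms(1,2)])

lemma smooth_map_bilinear:
  assumes "bounded_bilinear h"
    and "charts_cover A" "open W" "smooth_map A euclidean_atlas W f" "smooth_map A euclidean_atlas W g"
  shows "smooth_map A euclidean_atlas W (\<lambda>p. h (f p) (g p))"
  using assms(4,5) unfolding smooth_map_to_euclidean_iff[OF assms(2,3)]
  by (auto intro!: smooth_on_bilinear[OF assms(1)] chart_image_Int_open[OF assms(2,3)])

lemmas smooth_map_scaleR = smooth_map_bilinear[OF bounded_bilinear_scaleR]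
  and smooth_map_inner = smooth_map_bilinear[OF bounded_bilinear_inner]
  and smooth_map_mult = smooth_map_bilinear[OF bounded_bilinear_mult[where 'a=real]]

text \<open>
  The main tool for turning local objects into global ones: \<open>V\<close> and the complement of \<open>K\<close> form an open cover, on whose
  members the extended map is \<open>f\<close> and \<open>z\<close>, respectively.
\<close>

lemma smooth_map_extend:
  assumes cov: "charts_cover A" "charts_cover B" and V: "open V" and K: "closed K" "K \<subseteq> V"
    and f: "smooth_map A B V f" and z: "smooth_map A B UNIV z"
    and eq: "\<And>q. q \<in> V \<Longrightarrow> q \<notin> K \<Longrightarrow> f q = z q"
  shows "smooth_map A B UNIV (\<lambda>q. if q \<in> V then f q else z q)" (is "smooth_map A B UNIV ?g")
proof (rule smooth_map_local[OF cov])
  fix q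
  have 1: "smooth_map A B V ?g"
    by (rule smooth_map_cong[OF cov V _ f]) simp
  have "smooth_map A B (- K) ?g"
    by (rule smooth_map_cong[OF cov _ _ smooth_map_subset[OF z]]) (use eq K in \<open>auto simp: open_Compl\<close>)
  with 1 show "\<exists>G. open G \<and> q \<in> G \<and> smooth_map A B G ?g"
    using V K by (cases "q \<in> V") (blast, intro exI[of _ "- K"], auto simp: open_Compl)
qed

text \<open>
  Transport of a Euclidean bump function by a chart. The Hausdorff property is essential: it makes the compact
  support \<open>K\<close>, a priori only a subset of the chart domain, closed in the whole manifold.
\<close>

lemma exists_smooth_bump:
  fixes A :: "('m::t2_space, 'x::euclidean_space) chart set"
  assumes A: "smooth_atlas A" and W: "open W" "p \<in> W"
  obtains \<beta> K G where "\<beta> \<in> smooth_functions A" "closed K" "K \<subseteq> W" "\<And>q. q \<notin> K \<Longrightarrow> \<beta> q = 0"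
    "open G" "p \<in> G" "G \<subseteq> W" "\<And>q. q \<in> G \<Longrightarrow> \<beta> q = 1"
proof -
  note cov = smooth_atlas_charts_cover[OF A]
  obtain V \<phi> where V: "(V, \<phi>) \<in> A" "p \<in> V" "is_chart (V, \<phi>)" by (rule charts_coverE[OF cov])
  note ch = is_chart_simps[OF V(3)]
  have "open (\<phi> ` (V \<inter> W))" using ch(1) W(1) by (intro chart_image_open[OF V(3)]) auto
  moreover have "\<phi> p \<in> \<phi> ` (V \<inter> W)" using V W by auto
  ultimately obtain r where r: "r > 0" "cball (\<phi> p) r \<subseteq> \<phi> ` (V \<inter> W)"
    by (meson open_contains_cball)
  obtain b :: "'x \<Rightarrow> real" where b: "smooth_on UNIV b" "\<And>x. x \<in> ball (\<phi> p) (r/2) \<Longrightarrow> b x = 1"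
      "\<And>x. x \<notin> ball (\<phi> p) r \<Longrightarrow> b x = 0"
    using exists_smooth_bump_ball[OF r(1)] by blast
  define \<beta> where "\<beta> q = (if q \<in> V then b (\<phi> q) else 0)" for q
  define K where "K = inv_into V \<phi> ` cball (\<phi> p) r"
  have cb: "cball (\<phi> p) r \<subseteq> \<phi> ` V" using r(2) by auto
  have "compact K"
    unfolding K_def using continuous_on_subset[OF ch(5) cb] by (intro compact_continuous_image) auto
  then have K: "closed K" by (rule compact_imp_closed)
  have KW: "K \<subseteq> W" unfolding K_def using r(2) ch(7) by force
  have z: "\<beta> q = 0" if "q \<notin> K" for q
  proof (cases "q \<in> V")
    case True
    then have "\<phi> q \<notin> cball (\<phi> p) r" using that ch(7)[OF True] unfolding K_def by force
    then show ?thesis using b(3)[of "\<phi> q"] True by (simp add: \<beta>_def less_imp_le)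
  qed (simp add: \<beta>_def)
  have "smooth_map A euclidean_atlas V (\<lambda>q. b (\<phi> q))"
    by (rule smooth_map_compose[OF cov charts_cover_euclidean_atlas charts_cover_euclidean_atlas ch(1) open_UNIV
          smooth_map_chart[OF A V(1)] smooth_map_euclidean_iff[OF open_UNIV, THEN iffD2, OF b(1)]]) auto
  moreover have "K \<subseteq> V" unfolding K_def using r(2) ch(7) by force
  moreover have "b (\<phi> q) = 0" if "q \<in> V" "q \<notin> K" for q
    using z[OF that(2)] that(1) by (simp add: \<beta>_def)
  ultimately have "smooth_map A euclidean_atlas UNIV \<beta>"
    unfolding \<beta>_def using smooth_map_const_euclidean[OF cov open_UNIV]
    by (intro smooth_map_extend[OF cov charts_cover_euclidean_atlas ch(1) K]) auto
  then have "\<beta> \<in> smooth_functions A" by (simp add: smooth_functions_def)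
  moreover have "open (V \<inter> \<phi> -` ball (\<phi> p) (r/2))"
    using ch by (intro continuous_open_preimage) auto
  moreover have "V \<inter> \<phi> -` ball (\<phi> p) (r/2) \<subseteq> W"
  proof
    fix q assume q: "q \<in> V \<inter> \<phi> -` ball (\<phi> p) (r/2)"
    then have "\<phi> q \<in> cball (\<phi> p) r" using r(1) by auto
    then have "\<phi> q \<in> \<phi> ` (V \<inter> W)" using r(2) by blast
    then show "q \<in> W" using q ch(6) by (auto dest: inj_onD)
  qed
  moreover have "\<beta> q = 1" if "q \<in> V \<inter> \<phi> -` ball (\<phi> p) (r/2)" for q
    using that b(2) by (auto simp: \<beta>_def)
  ultimately show ?thesis
    using that[OF _ K KW z, where G = "V \<inter> \<phi> -` ball (\<phi> p) (r/2)"] V(2) r(1) by auto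
qed

section \<open>Dense subsets\<close>

text \<open>
  In a slice chart, an open subset of the submanifold would be an open subset of a proper subspace.
\<close>

lemma complement_of_submanifold_dense:
  fixes A :: "('m::topological_space, 'x::euclidean_space) chart set"
  assumes A: "smooth_atlas A" and N: "embedded_submanifold A k N" "k \<ge> 2" "- U \<subseteq> N"
    and W: "open W" "W \<noteq> {}"
  shows "W \<inter> U \<noteq> {}"
proof (rule ccontr)
  assume *: "\<not> W \<inter> U \<noteq> {}"
  obtain p where p: "p \<in> W" "p \<in> N" using W(2) N(3) * by blast
  obtain V \<phi> L where V: "(V, \<phi>) \<in> A" "p \<in> V" "dim L + k = DIM('x)" "\<phi> ` (V \<inter> N) = \<phi> ` V \<inter> L"
    using N(1) p(2) unfolding embedded_submanifold_def by blast
  have "open (\<phi> ` (V \<inter> W))"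
    by (rule chart_image_Int_open[OF smooth_atlas_charts_cover[OF A] W(1) V(1)])
  then obtain y where y: "y \<in> \<phi> ` (V \<inter> W)" "y \<notin> span (insert 0 L)"
    using exists_generic_point[of L "\<phi> ` (V \<inter> W)"] V(2,3) N(2) p(1) by (metis IntI add_le_cancel_left empty_iff image_eqI)
  then obtain q where q: "y = \<phi> q" "q \<in> V" "q \<in> W" by blast
  then have "q \<in> N" using * N(3) by blast
  then have "y \<in> L" using q V(4) by blast
  then show False using y(2) span_base by blast
qed

lemma continuous_eq_on_dense:
  fixes f g :: "'m::topological_space \<Rightarrow> 'e::t2_space"
  assumes dense: "\<And>W. open W \<Longrightarrow> W \<noteq> {} \<Longrightarrow> W \<inter> U \<noteq> {}"
    and W: "open W" "continuous_on W f" "continuous_on W g"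
    and eq: "\<And>q. q \<in> W \<Longrightarrow> q \<in> U \<Longrightarrow> f q = g q" and p: "p \<in> W"
  shows "f p = g p"
proof (rule ccontr)
  assume "f p \<noteq> g p"
  from hausdorff[OF this] obtain P Q where PQ: "open P" "open Q" "f p \<in> P" "g p \<in> Q" "P \<inter> Q = {}"
    by blast
  have "open ((W \<inter> f -` P) \<inter> (W \<inter> g -` Q))"
    by (rule open_Int[OF continuous_open_preimage[OF W(2,1) PQ(1)] continuous_open_preimage[OF W(3,1) PQ(2)]])
  moreover have "p \<in> (W \<inter> f -` P) \<inter> (W \<inter> g -` Q)" using p PQ by auto
  ultimately obtain q where q: "q \<in> (W \<inter> f -` P) \<inter> (W \<inter> g -` Q)" "q \<in> U" using dense by blast
  then have "f q \<in> P \<inter> Q" using eq[of q] by auto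
  then show False using PQ(5) by blast
qed

section \<open>Vector bundles and local trivializations\<close>

locale bundle_with_connection =
  fixes B :: "('m::t2_space, 'e::t2_space, 'x::euclidean_space, 'f::euclidean_space) vbundle"
    and D :: "'m vfield \<Rightarrow> ('m \<Rightarrow> 'e) \<Rightarrow> 'm \<Rightarrow> 'e"
  assumes vb: "vector_bundle B" and conn: "linear_connection B D"
begin

lemma atlas_base: "smooth_atlas (base B)" and atlas_total: "smooth_atlas (total B)"
  and proj_smooth: "smooth_map (total B) (base B) UNIV (proj B)"
  and fibre_vs: "real_vector_space_on (fibre B p) (fadd B) (fzero B p) (fscale B)"
  using vb by (auto simp: vector_bundle_def smooth_structure_def)

lemmas cov_base = smooth_atlas_charts_cover[OF atlas_base]
  and cov_total = smooth_atlas_charts_cover[OF atlas_total]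
  and cov_euclid = charts_cover_euclidean_atlas

lemma fibre_closed:
  "fzero B p \<in> fibre B p"
  "u \<in> fibre B p \<Longrightarrow> v \<in> fibre B p \<Longrightarrow> fadd B u v \<in> fibre B p"
  "u \<in> fibre B p \<Longrightarrow> fscale B a u \<in> fibre B p"
  using fibre_vs[of p] by (auto simp: real_vector_space_on_def)

text \<open>
  The inverse of a local trivialization with second component \<open>\<Phi>\<close>, fibre by fibre.
\<close>

definition lift :: "'m set \<Rightarrow> ('e \<Rightarrow> 'f) \<Rightarrow> 'm \<Rightarrow> 'f \<Rightarrow> 'e" where
  "lift V \<Phi> q a = inv_into (proj B -` V) (\<lambda>e. (proj B e, \<Phi> e)) (q, a)"

lemma exists_trivialization: obtains V \<Phi> where "p \<in> V" "local_trivialization B V \<Phi>"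
  using vb that unfolding vector_bundle_def by blast

context
  fixes V \<Phi> assumes triv: "local_trivialization B V \<Phi>"
begin

lemma triv_open: "open V"
  and triv_bij: "bij_betw (\<lambda>e. (proj B e, \<Phi> e)) (proj B -` V) (V \<times> UNIV)"
  and triv_map_smooth: "smooth_map (total B) (prod_atlas (base B) euclidean_atlas) (proj B -` V) (\<lambda>e. (proj B e, \<Phi> e))"
  and triv_inv_smooth: "smooth_map (prod_atlas (base B) euclidean_atlas) (total B) (V \<times> UNIV)
        (inv_into (proj B -` V) (\<lambda>e. (proj B e, \<Phi> e)))"
  and triv_fadd: "q \<in> V \<Longrightarrow> u \<in> fibre B q \<Longrightarrow> v \<in> fibre B q \<Longrightarrow> \<Phi> (fadd B u v) = \<Phi> u + \<Phi> v"
  and triv_fscale: "q \<in> V \<Longrightarrow> u \<in> fibre B q \<Longrightarrow> \<Phi> (fscale B a u) = a *\<^sub>R \<Phi> u"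
  using triv by (auto simp: local_trivialization_def Let_def)

lemma lift_in_fibre: "q \<in> V \<Longrightarrow> lift V \<Phi> q a \<in> fibre B q"
  and triv_lift: "q \<in> V \<Longrightarrow> \<Phi> (lift V \<Phi> q a) = a"
  using bij_betw_inv_into_right[OF triv_bij, of "(q, a)"] by (auto simp: lift_def fibre_def)

lemma lift_triv: "q \<in> V \<Longrightarrow> e \<in> fibre B q \<Longrightarrow> lift V \<Phi> q (\<Phi> e) = e"
  using bij_betw_inv_into_left[OF triv_bij, of e] by (auto simp: lift_def fibre_def)

lemma triv_inj: "q \<in> V \<Longrightarrow> u \<in> fibre B q \<Longrightarrow> v \<in> fibre B q \<Longrightarrow> \<Phi> u = \<Phi> v \<Longrightarrow> u = v"
  by (metis lift_triv)

lemma triv_fzero: assumes "q \<in> V" shows "\<Phi> (fzero B q) = 0"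
proof -
  have "fadd B (fzero B q) (fzero B q) = fzero B q"
    using fibre_vs[of q] by (auto simp: real_vector_space_on_def)
  then show ?thesis using triv_fadd[OF assms fibre_closed(1) fibre_closed(1)] by simp
qed

lemma lift_zero: "q \<in> V \<Longrightarrow> lift V \<Phi> q 0 = fzero B q"
  using lift_triv[of q "fzero B q"] triv_fzero fibre_closed(1) by simp

lemma lift_add: "q \<in> V \<Longrightarrow> lift V \<Phi> q (a + b) = fadd B (lift V \<Phi> q a) (lift V \<Phi> q b)"
  by (rule triv_inj) (auto simp: triv_lift triv_fadd lift_in_fibre fibre_closed)

lemma lift_scale: "q \<in> V \<Longrightarrow> lift V \<Phi> q (c *\<^sub>R a) = fscale B c (lift V \<Phi> q a)"
  by (rule triv_inj) (auto simp: triv_lift triv_fscale lift_in_fibre fibre_closed)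

lemma triv_smooth: "smooth_map (total B) euclidean_atlas (proj B -` V) \<Phi>"
proof -
  have "open (UNIV \<inter> proj B -` V)"
    by (rule continuous_open_preimage[OF smooth_mapD(1)[OF proj_smooth] open_UNIV triv_open])
  then have "smooth_map (total B) euclidean_atlas (proj B -` V) (\<lambda>e. snd (proj B e, \<Phi> e))"
    by (intro smooth_map_compose[OF cov_total charts_cover_prod_atlas[OF cov_base cov_euclid] cov_euclid _ open_UNIV
          triv_map_smooth smooth_map_snd[OF cov_base]]) auto
  then show ?thesis by simp
qed

lemma smooth_triv_section:
  assumes "section_on B W \<sigma>" "open W" "W \<subseteq> V"
  shows "smooth_map (base B) euclidean_atlas W (\<lambda>q. \<Phi> (\<sigma> q))"
proof (rule smooth_map_compose[OF cov_base cov_total cov_euclid assms(2) _ _ triv_smooth])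
  show "open (proj B -` V)"
    using continuous_open_preimage[OF smooth_mapD(1)[OF proj_smooth] open_UNIV triv_open] by simp
qed (use assms in \<open>auto simp: section_on_def fibre_def\<close>)

lemma section_lift:
  assumes "smooth_map (base B) euclidean_atlas W f" "open W" "W \<subseteq> V"
  shows "section_on B W (\<lambda>q. lift V \<Phi> q (f q))"
  unfolding section_on_def
proof (intro conjI ballI)
  have "smooth_map (base B) (prod_atlas (base B) euclidean_atlas) W (\<lambda>q. (q, f q))"
    by (rule smooth_map_Pair[OF cov_base cov_base cov_euclid assms(2) smooth_map_id[OF atlas_base] assms(1)])
  from smooth_map_compose[OF cov_base charts_cover_prod_atlas[OF cov_base cov_euclid] cov_total assms(2) _ this triv_inv_smooth]
  show "smooth_map (base B) (total B) W (\<lambda>q. lift V \<Phi> q (f q))"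
    using assms(3) triv_open by (auto simp: lift_def open_Times)
qed (use lift_in_fibre assms(3) in blast)

end

text \<open>
  Smoothness of the zero section makes it a legitimate default value outside the support of a local section.
\<close>

lemma section_fzero: "section_on B UNIV (fzero B)"
  unfolding section_on_def
proof (intro conjI ballI fibre_closed smooth_map_local[OF cov_base cov_total])
  fix p
  obtain V \<Phi> where V: "p \<in> V" "local_trivialization B V \<Phi>" by (rule exists_trivialization)
  note o = triv_open[OF V(2)]
  have "smooth_map (base B) (total B) V (\<lambda>q. lift V \<Phi> q 0)"
    using section_lift[OF V(2) smooth_map_const_euclidean[OF cov_base o] o] by (simp add: section_on_def)
  then have "smooth_map (base B) (total B) V (fzero B)"
    by (rule smooth_map_cong[OF cov_base cov_total o, rotated]) (simp add: lift_zero[OF V(2)])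
  then show "\<exists>G. open G \<and> p \<in> G \<and> smooth_map (base B) (total B) G (fzero B)"
    using V(1) o by blast
qed

lemma section_extend_lift:
  assumes triv: "local_trivialization B V \<Phi>" and K: "closed K" "K \<subseteq> V"
    and f: "smooth_map (base B) euclidean_atlas V f" "\<And>q. q \<in> V \<Longrightarrow> q \<notin> K \<Longrightarrow> f q = 0"
  shows "section_on B UNIV (\<lambda>q. if q \<in> V then lift V \<Phi> q (f q) else fzero B q)"
  unfolding section_on_def
proof (intro conjI ballI)
  note o = triv_open[OF triv]
  show "smooth_map (base B) (total B) UNIV (\<lambda>q. if q \<in> V then lift V \<Phi> q (f q) else fzero B q)"
    using section_lift[OF triv f(1) o] section_fzero f(2) lift_zero[OF triv]
    by (intro smooth_map_extend[OF cov_base cov_total o K]) (auto simp: section_on_def)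
qed (auto simp: lift_in_fibre[OF triv] fibre_closed)

lemma fscale_zero: "u \<in> fibre B p \<Longrightarrow> fscale B 0 u = fzero B p"
  and fscale_one: "u \<in> fibre B p \<Longrightarrow> fscale B 1 u = u"
  and fadd_left_cancel: "u \<in> fibre B p \<Longrightarrow> v \<in> fibre B p \<Longrightarrow> w \<in> fibre B p \<Longrightarrow> fadd B w u = fadd B w v \<Longrightarrow> u = v"
proof -
  obtain V \<Phi> where V: "p \<in> V" "local_trivialization B V \<Phi>" by (rule exists_trivialization)
  note simps = triv_fadd[OF V(2,1)] triv_fscale[OF V(2,1)] triv_fzero[OF V(2,1)] fibre_closed
  show "u \<in> fibre B p \<Longrightarrow> fscale B 0 u = fzero B p" and "u \<in> fibre B p \<Longrightarrow> fscale B 1 u = u"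
    by (rule triv_inj[OF V(2,1)]; simp add: simps)+
  assume a: "u \<in> fibre B p" "v \<in> fibre B p" "w \<in> fibre B p" "fadd B w u = fadd B w v"
  have "\<Phi> w + \<Phi> u = \<Phi> w + \<Phi> v"
    using arg_cong[OF a(4), of \<Phi>] by (simp add: simps(1) a(1-3))
  then show "u = v" by (intro triv_inj[OF V(2,1) a(1,2)]) simp
qed

section \<open>Locality of connections\<close>

lemma
  assumes "vector_field_on (base B) UNIV X" "section_on B UNIV \<sigma>"
  shows connection_section: "section_on B UNIV (D X \<sigma>)"
    and connection_scale_field: "f \<in> smooth_functions (base B) \<Longrightarrow> D (\<lambda>q h. f q * X q h) \<sigma> p = fscale B (f p) (D X \<sigma> p)"
    and connection_add: "section_on B UNIV \<tau> \<Longrightarrow> D X (\<lambda>q. fadd B (\<sigma> q) (\<tau> q)) p = fadd B (D X \<sigma> p) (D X \<tau> p)"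
    and connection_leibniz: "f \<in> smooth_functions (base B) \<Longrightarrow>
      D X (\<lambda>q. fscale B (f q) (\<sigma> q)) p = fadd B (fscale B (X p f) (\<sigma> p)) (fscale B (f p) (D X \<sigma> p))"
  using conn assms unfolding linear_connection_def by blast+

lemma section_in_fibre: "section_on B W \<sigma> \<Longrightarrow> p \<in> W \<Longrightarrow> \<sigma> p \<in> fibre B p"
  by (simp add: section_on_def)

text \<open>
  Let \<open>\<beta>\<close> be a bump function at \<open>p\<close> with support in \<open>W\<close>. Multiplication by \<open>\<beta>\<close> makes the fields, and then the sections,
  equal everywhere, while the axioms recover the original values at \<open>p\<close>, where \<open>\<beta>\<close> is \<open>1\<close>. The Leibniz term
  \<open>(Y \<beta>) \<sigma>\<close> does no harm: at \<open>p\<close> it is the same for \<open>\<sigma>\<close> and \<open>\<tau>\<close> and cancels.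
\<close>

lemma connection_local:
  assumes X: "vector_field_on (base B) UNIV X" and Y: "vector_field_on (base B) UNIV Y"
    and \<sigma>: "section_on B UNIV \<sigma>" and \<tau>: "section_on B UNIV \<tau>"
    and W: "open W" "p \<in> W" and eq: "\<And>q. q \<in> W \<Longrightarrow> X q = Y q" "\<And>q. q \<in> W \<Longrightarrow> \<sigma> q = \<tau> q"
  shows "D X \<sigma> p = D Y \<tau> p"
proof -
  obtain \<beta> K G where \<beta>: "\<beta> \<in> smooth_functions (base B)" "K \<subseteq> W" "\<And>q. q \<notin> K \<Longrightarrow> \<beta> q = 0"
      and "p \<in> G" "\<And>q. q \<in> G \<Longrightarrow> \<beta> q = 1"
    using exists_smooth_bump[OF atlas_base W] by metis
  then have 1: "\<beta> p = 1" by blast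
  have F: "D X \<sigma> p \<in> fibre B p" "D Y \<sigma> p \<in> fibre B p" "D Y \<tau> p \<in> fibre B p"
    using connection_section X Y \<sigma> \<tau> section_in_fibre by blast+
  have off: "\<beta> q = 0" if "q \<notin> W" for q using \<beta>(2,3) that by blast
  have "(\<lambda>q h. \<beta> q * X q h) = (\<lambda>q h. \<beta> q * Y q h)"
    using eq(1) off by (intro ext) (metis mult_zero_left)
  then have "D X \<sigma> p = D Y \<sigma> p"
    using connection_scale_field[OF X \<sigma> \<beta>(1), of p] connection_scale_field[OF Y \<sigma> \<beta>(1), of p] 1
    by (simp add: fscale_one[OF F(1)] fscale_one[OF F(2)])
  moreover have "(\<lambda>q. fscale B (\<beta> q) (\<sigma> q)) = (\<lambda>q. fscale B (\<beta> q) (\<tau> q))"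
  proof
    fix q show "fscale B (\<beta> q) (\<sigma> q) = fscale B (\<beta> q) (\<tau> q)"
      using eq(2)[of q] off[of q] fscale_zero[OF section_in_fibre[OF \<sigma> UNIV_I], of q]
        fscale_zero[OF section_in_fibre[OF \<tau> UNIV_I], of q] by (cases "q \<in> W") auto
  qed
  then have "fadd B (fscale B (Y p \<beta>) (\<sigma> p)) (D Y \<sigma> p) = fadd B (fscale B (Y p \<beta>) (\<sigma> p)) (D Y \<tau> p)"
    using connection_leibniz[OF Y \<sigma> \<beta>(1), of p] connection_leibniz[OF Y \<tau> \<beta>(1), of p] 1 eq(2)[OF W(2)]
    by (simp add: fscale_one[OF F(2)] fscale_one[OF F(3)])
  then have "D Y \<sigma> p = D Y \<tau> p"
    by (rule fadd_left_cancel[OF F(2,3), rotated]) (intro fibre_closed section_in_fibre[OF \<sigma>] UNIV_I)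
  ultimately show ?thesis by simp
qed

text \<open>
  By locality, the value of the induced connection is the unique one that its definition describes, and \<open>X\<close>, \<open>\<tau>\<close>
  are admissible choices there.
\<close>

lemma parallel_imp_connection_zero:
  assumes par: "parallel_section_on B D U \<sigma>"
    and X: "vector_field_on (base B) UNIV X" and \<tau>: "section_on B UNIV \<tau>"
    and G: "open G" "p \<in> G" "G \<subseteq> U" "\<And>q. q \<in> G \<Longrightarrow> \<tau> q = \<sigma> q"
  shows "D X \<tau> p = fzero B p"
proof -
  have "vector_field_on (base B) U X"
    using X smooth_map_subset[of _ _ UNIV _ U] unfolding vector_field_on_def by blast
  then have "induced_connection B D U X \<sigma> p = fzero B p"
    using par G unfolding parallel_section_on_def by blast
  moreover have "induced_connection B D U X \<sigma> p = D X \<tau> p"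
    unfolding induced_connection_def
  proof (rule the_equality)
    show "\<exists>Y \<tau>' O'. vector_field_on (base B) UNIV Y \<and> section_on B UNIV \<tau>' \<and> open O' \<and> p \<in> O' \<and> O' \<subseteq> U \<and>
        (\<forall>q\<in>O'. Y q = X q \<and> \<tau>' q = \<sigma> q) \<and> D X \<tau> p = D Y \<tau>' p"
      using X \<tau> G by blast
    fix e assume "\<exists>Y \<tau>' O'. vector_field_on (base B) UNIV Y \<and> section_on B UNIV \<tau>' \<and> open O' \<and> p \<in> O' \<and> O' \<subseteq> U \<and>
        (\<forall>q\<in>O'. Y q = X q \<and> \<tau>' q = \<sigma> q) \<and> e = D Y \<tau>' p"
    then obtain Y \<tau>' O' where *: "vector_field_on (base B) UNIV Y" "section_on B UNIV \<tau>'" "open O'" "p \<in> O'"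
        "\<And>q. q \<in> O' \<Longrightarrow> Y q = X q" "\<And>q. q \<in> O' \<Longrightarrow> \<tau>' q = \<sigma> q" "e = D Y \<tau>' p" by blast
    have "D Y \<tau>' p = D X \<tau> p"
      by (rule connection_local[OF *(1) X *(2) \<tau>, of "O' \<inter> G"]) (use * G in auto)
    then show "e = D X \<tau> p" using *(7) by simp
  qed
  ultimately show ?thesis by simp
qed

section \<open>Connections in local coordinates\<close>

lemma smooth_function_in_chart:
  assumes "smooth_map (base B) euclidean_atlas UNIV f" "(V, \<phi>) \<in> base B"
  shows "smooth_on (\<phi> ` V) (\<lambda>x. f (inv_into V \<phi> x))"
  using assms(1)[unfolded smooth_map_to_euclidean_iff[OF cov_base open_UNIV], rule_format, OF assms(2)] by simp

text \<open>
  The coordinate field in direction \<open>v\<close> of a chart, cut off by \<open>\<beta>\<close>. Tangent vectors vanish by convention on functions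
  that are not smooth, whence the second condition.
\<close>

definition coord_field :: "'m set \<Rightarrow> ('m \<Rightarrow> 'x) \<Rightarrow> ('m \<Rightarrow> real) \<Rightarrow> 'x \<Rightarrow> 'm vfield" where
  "coord_field V \<phi> \<beta> v q h = (if q \<in> V \<and> h \<in> smooth_functions (base B)
     then \<beta> q * frechet_derivative (\<lambda>x. h (inv_into V \<phi> x)) (at (\<phi> q)) v else 0)"

lemma vector_field_coord_field:
  assumes c: "(V, \<phi>) \<in> base B" and \<beta>: "\<beta> \<in> smooth_functions (base B)"
    and K: "closed K" "K \<subseteq> V" "\<And>q. q \<notin> K \<Longrightarrow> \<beta> q = 0"
  shows "vector_field_on (base B) UNIV (coord_field V \<phi> \<beta> v)"
  unfolding vector_field_on_def
proof (intro conjI ballI)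
  note ch = is_chart_simps[OF charts_coverD[OF cov_base c]]
  have d: "((\<lambda>x. f (inv_into V \<phi> x)) has_derivative frechet_derivative (\<lambda>x. f (inv_into V \<phi> x)) (at (\<phi> q))) (at (\<phi> q))"
    if "f \<in> smooth_functions (base B)" "q \<in> V" for f q
    by (rule smooth_on_differentiable[OF smooth_function_in_chart[OF _ c]])
       (use that in \<open>auto simp: smooth_functions_def\<close>)
  fix p
  show "coord_field V \<phi> \<beta> v p \<in> tangent_space (base B) p"
    unfolding tangent_space_def mem_Collect_eq
  proof (intro conjI ballI allI impI)
    fix f g a b assume f: "f \<in> smooth_functions (base B)" and g: "g \<in> smooth_functions (base B)"
    have 1: "(\<lambda>q. a * f q + b * g q) \<in> smooth_functions (base B)"
      using f g by (auto simp: smooth_functions_def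
          intro!: smooth_map_add smooth_map_mult smooth_map_const_euclidean cov_base)
    have 2: "(\<lambda>q. f q * g q) \<in> smooth_functions (base B)"
      using f g by (auto simp: smooth_functions_def intro!: smooth_map_mult cov_base)
    show "coord_field V \<phi> \<beta> v p (\<lambda>q. a * f q + b * g q) = a * coord_field V \<phi> \<beta> v p f + b * coord_field V \<phi> \<beta> v p g"
    proof (cases "p \<in> V")
      case True
      have "((\<lambda>x. a * f (inv_into V \<phi> x) + b * g (inv_into V \<phi> x)) has_derivative
        (\<lambda>w. a * frechet_derivative (\<lambda>x. f (inv_into V \<phi> x)) (at (\<phi> p)) w
           + b * frechet_derivative (\<lambda>x. g (inv_into V \<phi> x)) (at (\<phi> p)) w)) (at (\<phi> p))"
        by (intro has_derivative_add has_derivative_mult_right d f g True)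
      from frechet_derivative_at[OF this, symmetric] show ?thesis
        using True f g 1 by (simp add: coord_field_def algebra_simps)
    qed (simp add: coord_field_def)
    show "coord_field V \<phi> \<beta> v p (\<lambda>q. f q * g q) = coord_field V \<phi> \<beta> v p f * g p + f p * coord_field V \<phi> \<beta> v p g"
    proof (cases "p \<in> V")
      case True
      from frechet_derivative_at[OF has_derivative_mult[OF d[OF f True] d[OF g True]], symmetric]
      show ?thesis
        using True f g 2 ch(7)[OF True] by (simp add: coord_field_def algebra_simps)
    qed (simp add: coord_field_def)
  qed (simp add: coord_field_def)
next
  note ch = is_chart_simps[OF charts_coverD[OF cov_base c]]
  fix f assume f: "f \<in> smooth_functions (base B)"
  let ?d = "\<lambda>x. frechet_derivative (\<lambda>x. f (inv_into V \<phi> x)) (at x) v"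
  have "smooth_on (\<phi> ` V) ?d"
    using f by (intro smooth_on_frechet_derivative smooth_function_in_chart[OF _ c]) (simp add: smooth_functions_def)
  then have "smooth_map (base B) euclidean_atlas V (\<lambda>q. ?d (\<phi> q))"
    by (intro smooth_map_compose[OF cov_base cov_euclid cov_euclid ch(1,2) smooth_map_chart[OF atlas_base c]])
       (auto simp: smooth_map_euclidean_iff ch)
  moreover have "smooth_map (base B) euclidean_atlas V \<beta>"
    using \<beta> by (auto simp: smooth_functions_def intro: smooth_map_subset)
  ultimately have "smooth_map (base B) euclidean_atlas V (\<lambda>q. \<beta> q * ?d (\<phi> q))"
    by (intro smooth_map_mult cov_base ch(1))
  from smooth_map_extend[OF cov_base cov_euclid ch(1) K(1,2) this smooth_map_const_euclidean[OF cov_base open_UNIV, of 0]]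
  show "smooth_map (base B) euclidean_atlas UNIV (\<lambda>p. coord_field V \<phi> \<beta> v p f)"
    using K(3) f by (simp add: coord_field_def)
qed

text \<open>
  In the following, \<open>\<beta>\<close> is supported in the common domain of a chart and a local trivialization and equals \<open>1\<close>
  on \<open>G\<close>. On \<open>G\<close>, the cut-off fields and sections are thus the true coordinate fields and frame sections.
\<close>

context
  fixes V1 \<Phi> V \<phi> \<beta> K G
  assumes triv: "local_trivialization B V1 \<Phi>" and chart: "(V, \<phi>) \<in> base B"
    and \<beta>: "\<beta> \<in> smooth_functions (base B)"
    and K: "closed K" "K \<subseteq> V \<inter> V1" "\<And>q. q \<notin> K \<Longrightarrow> \<beta> q = 0"
    and G: "open G" "G \<subseteq> V \<inter> V1" "\<And>q. q \<in> G \<Longrightarrow> \<beta> q = 1"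
begin

definition cut_section :: "('m \<Rightarrow> 'f) \<Rightarrow> 'm \<Rightarrow> 'e" where
  "cut_section f q = (if q \<in> V1 then lift V1 \<Phi> q (\<beta> q *\<^sub>R f q) else fzero B q)"

abbreviation "cfield v \<equiv> coord_field V \<phi> \<beta> v"

text \<open>
  The connection form: in the trivialization, \<open>\<nabla>\<close> is on \<open>G\<close> the directional derivative plus this
  endomorphism of the model fibre, evaluated here on a constant section \<open>b\<close>.
\<close>

definition conn_form :: "'x \<Rightarrow> 'f \<Rightarrow> 'm \<Rightarrow> 'f" where
  "conn_form v b q = \<Phi> (D (cfield v) (cut_section (\<lambda>_. b)) q)"

lemma cfield_vector_field: "vector_field_on (base B) UNIV (cfield v)"
  using K by (intro vector_field_coord_field[OF chart \<beta>, of K]) auto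

lemma section_cut_section:
  assumes "smooth_map (base B) euclidean_atlas UNIV f" shows "section_on B UNIV (cut_section f)"
proof -
  have "smooth_map (base B) euclidean_atlas V1 (\<lambda>q. \<beta> q *\<^sub>R f q)"
    using assms \<beta> by (intro smooth_map_scaleR cov_base triv_open[OF triv])
      (auto simp: smooth_functions_def intro: smooth_map_subset)
  then show ?thesis
    unfolding cut_section_def using K by (intro section_extend_lift[OF triv, of K]) auto
qed

lemma smooth_conn_form: "smooth_map (base B) euclidean_atlas V1 (conn_form v b)"
proof -
  have "section_on B UNIV (D (cfield v) (cut_section (\<lambda>_. b)))"
    by (intro connection_section cfield_vector_field section_cut_section smooth_map_const_euclidean cov_base open_UNIV)
  then have "section_on B V1 (D (cfield v) (cut_section (\<lambda>_. b)))"
    by (auto simp: section_on_def intro: smooth_map_subset)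
  then show ?thesis
    unfolding conn_form_def by (rule smooth_triv_section[OF triv _ triv_open[OF triv]]) simp
qed

text \<open>
  Additivity and the Leibniz rule applied to the frame expansion of a section. Fibres of the bundle carry no type class
  structure, so the sum is formed in the model fibre and the induction runs over the index set.
\<close>

lemma connection_cut_section_sum:
  assumes q: "q \<in> G" and f: "smooth_map (base B) euclidean_atlas UNIV f"
    and T: "finite T"
  shows "\<Phi> (D (cfield v) (cut_section (\<lambda>q. \<Sum>b\<in>T. (f q \<bullet> b) *\<^sub>R b)) q)
    = (\<Sum>b\<in>T. cfield v q (\<lambda>q. f q \<bullet> b) *\<^sub>R b + (f q \<bullet> b) *\<^sub>R conn_form v b q)"
  using T
proof (induction T)
  have qV: "q \<in> V1" using q G(2) by blast
  have smT: "smooth_map (base B) euclidean_atlas UNIV (\<lambda>q. \<Sum>b\<in>T. (f q \<bullet> b) *\<^sub>R b)" for T :: "'f set"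
    using f by (simp add: smooth_map_to_euclidean_iff[OF cov_base open_UNIV])
      (auto intro!: smooth_on_sum smooth_on_scaleR smooth_on_inner smooth_on_const
         is_chart_simps(2)[OF charts_coverD[OF cov_base]])
  note fib = section_in_fibre[OF _ UNIV_I]
  note DF = fib[OF connection_section[OF cfield_vector_field section_cut_section]]
  note \<Phi>add = triv_fadd[OF triv qV] and \<Phi>scale = triv_fscale[OF triv qV]
  {
    case empty
    have s0: "section_on B UNIV (cut_section (\<lambda>_. 0))"
      by (intro section_cut_section smooth_map_const_euclidean cov_base open_UNIV)
    \<comment> \<open>The zero section is its own double, hence so is its covariant derivative.\<close>
    have "(\<lambda>q. fadd B (cut_section (\<lambda>_. 0) q) (cut_section (\<lambda>_. 0) q)) = cut_section (\<lambda>_. 0)"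
    proof
      fix q show "fadd B (cut_section (\<lambda>_. 0) q) (cut_section (\<lambda>_. 0) q) = cut_section (\<lambda>_. 0) q"
        using fibre_vs[of q] by (auto simp: cut_section_def lift_zero[OF triv] real_vector_space_on_def)
    qed
    with connection_add[OF cfield_vector_field s0 s0]
    have "D (cfield v) (cut_section (\<lambda>_. 0)) q = fadd B (D (cfield v) (cut_section (\<lambda>_. 0)) q) (D (cfield v) (cut_section (\<lambda>_. 0)) q)"
      by simp
    from arg_cong[OF this, of \<Phi>] have "\<Phi> (D (cfield v) (cut_section (\<lambda>_. 0)) q) = 0"
      using \<Phi>add[OF fib[OF connection_section[OF cfield_vector_field s0]] fib[OF connection_section[OF cfield_vector_field s0]]] by simp
    then show ?case by simp
  next
    case (insert b T)
    let ?F = "cut_section (\<lambda>q. \<Sum>b\<in>T. (f q \<bullet> b) *\<^sub>R b)" and ?b = "cut_section (\<lambda>_. b)"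
    have s: "section_on B UNIV ?F" by (rule section_cut_section[OF smT])
    have sb: "section_on B UNIV ?b"
      by (intro section_cut_section smooth_map_const_euclidean cov_base open_UNIV)
    have fb: "(\<lambda>q. f q \<bullet> b) \<in> smooth_functions (base B)"
      using f by (auto simp: smooth_functions_def intro!: smooth_map_inner smooth_map_const_euclidean cov_base)
    have sfb: "section_on B UNIV (cut_section (\<lambda>q. (f q \<bullet> b) *\<^sub>R b))"
      using smT[of "{b}"] by (intro section_cut_section) simp
    have 1: "cut_section (\<lambda>q. \<Sum>b\<in>insert b T. (f q \<bullet> b) *\<^sub>R b) = (\<lambda>q. fadd B (cut_section (\<lambda>q. (f q \<bullet> b) *\<^sub>R b) q) (?F q))"
    proof
      fix q show "cut_section (\<lambda>q. \<Sum>b\<in>insert b T. (f q \<bullet> b) *\<^sub>R b) q = fadd B (cut_section (\<lambda>q. (f q \<bullet> b) *\<^sub>R b) q) (?F q)"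
        using fibre_vs[of q] insert(1,2)
        by (auto simp: cut_section_def scaleR_add_right lift_add[OF triv] real_vector_space_on_def)
    qed
    have 2: "cut_section (\<lambda>q. (f q \<bullet> b) *\<^sub>R b) = (\<lambda>q. fscale B (f q \<bullet> b) (?b q))"
    proof
      fix q show "cut_section (\<lambda>q. (f q \<bullet> b) *\<^sub>R b) q = fscale B (f q \<bullet> b) (?b q)"
      proof (cases "q \<in> V1")
        case True
        have "cut_section (\<lambda>q. (f q \<bullet> b) *\<^sub>R b) q = lift V1 \<Phi> q ((f q \<bullet> b) *\<^sub>R (\<beta> q *\<^sub>R b))"
          using True by (simp add: cut_section_def mult.commute)
        also have "\<dots> = fscale B (f q \<bullet> b) (lift V1 \<Phi> q (\<beta> q *\<^sub>R b))"
          by (rule lift_scale[OF triv True])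
        finally show ?thesis using True by (simp add: cut_section_def)
      next
        case False
        obtain V' \<Phi>' where V': "q \<in> V'" "local_trivialization B V' \<Phi>'" by (rule exists_trivialization)
        have "fscale B (f q \<bullet> b) (fzero B q) = fzero B q"
          using lift_scale[OF V'(2,1), of "f q \<bullet> b" 0] by (simp add: lift_zero[OF V'(2,1)])
        then show ?thesis using False by (simp add: cut_section_def)
      qed
    qed
    have "\<Phi> (D (cfield v) (cut_section (\<lambda>q. (f q \<bullet> b) *\<^sub>R b)) q)
        = cfield v q (\<lambda>q. f q \<bullet> b) *\<^sub>R \<Phi> (?b q) + (f q \<bullet> b) *\<^sub>R conn_form v b q"
      unfolding 2 connection_leibniz[OF cfield_vector_field sb fb] conn_form_def
      using fib[OF sb] fib[OF connection_section[OF cfield_vector_field sb]]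
      by (simp add: \<Phi>add \<Phi>scale fibre_closed)
    moreover have "\<Phi> (?b q) = b" using q qV G(3) by (simp add: cut_section_def triv_lift[OF triv])
    moreover have "\<Phi> (D (cfield v) (cut_section (\<lambda>q. \<Sum>b\<in>insert b T. (f q \<bullet> b) *\<^sub>R b)) q)
        = \<Phi> (D (cfield v) (cut_section (\<lambda>q. (f q \<bullet> b) *\<^sub>R b)) q) + \<Phi> (D (cfield v) ?F q)"
      unfolding 1 connection_add[OF cfield_vector_field sfb s]
      using fib[OF connection_section[OF cfield_vector_field sfb]] fib[OF connection_section[OF cfield_vector_field s]]
      by (simp add: \<Phi>add)
    ultimately show ?case using insert by simp
  }
qed

text \<open>
  The classical coordinate formula \<open>\<nabla>\<^sub>v f = \<partial>\<^sub>v f + A\<^sub>v f\<close>.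
\<close>

lemma connection_cut_section:
  assumes q: "q \<in> G" and f: "smooth_map (base B) euclidean_atlas UNIV f"
  shows "\<Phi> (D (cfield v) (cut_section f) q)
    = frechet_derivative (\<lambda>x. f (inv_into V \<phi> x)) (at (\<phi> q)) v + (\<Sum>b\<in>Basis. (f q \<bullet> b) *\<^sub>R conn_form v b q)"
proof -
  have qV: "q \<in> V" "\<beta> q = 1" using q G by auto
  let ?f' = "frechet_derivative (\<lambda>x. f (inv_into V \<phi> x)) (at (\<phi> q))"
  have d: "((\<lambda>x. f (inv_into V \<phi> x)) has_derivative ?f') (at (\<phi> q))"
    by (rule smooth_on_differentiable[OF smooth_function_in_chart[OF f chart]]) (use qV in auto)
  have "cfield v q (\<lambda>q. f q \<bullet> b) = ?f' v \<bullet> b" for b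
  proof -
    have "(\<lambda>q. f q \<bullet> b) \<in> smooth_functions (base B)"
      using f by (auto simp: smooth_functions_def intro!: smooth_map_inner smooth_map_const_euclidean cov_base)
    then show ?thesis
      using frechet_derivative_at[OF has_derivative_inner_left[OF d, of b], symmetric] qV
      by (simp add: coord_field_def)
  qed
  then show ?thesis
    using connection_cut_section_sum[OF q f finite_Basis, of v]
    by (simp add: euclidean_representation sum.distrib)
qed

text \<open>
  Since \<open>\<sigma>\<close> is defined on \<open>U\<close> only, the coordinate formula is applied to its coefficient function times a bump function
  at \<open>p\<close> with support in \<open>U\<close>; the resulting global section agrees with \<open>\<sigma>\<close> near \<open>p\<close>.
\<close>

lemma parallel_local_equation:
  assumes par: "parallel_section_on B D U \<sigma>" and U: "open U" and p: "p \<in> G" "p \<in> U"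
  shows "frechet_derivative (\<lambda>x. \<Phi> (\<sigma> (inv_into V \<phi> x))) (at (\<phi> p)) v
    = (\<Sum>b\<in>Basis. (\<Phi> (\<sigma> p) \<bullet> b) *\<^sub>R - conn_form v b p)"
proof -
  note ch = is_chart_simps[OF charts_coverD[OF cov_base chart]]
  note o1 = triv_open[OF triv]
  have oUG: "open (U \<inter> G)" using U G by auto
  obtain \<gamma> K' G' where \<gamma>: "\<gamma> \<in> smooth_functions (base B)" "closed K'" "K' \<subseteq> U \<inter> G" "\<And>q. q \<notin> K' \<Longrightarrow> \<gamma> q = 0"
      and G': "open G'" "p \<in> G'" "G' \<subseteq> U \<inter> G" "\<And>q. q \<in> G' \<Longrightarrow> \<gamma> q = 1"
    using exists_smooth_bump[OF atlas_base oUG, of p] p by auto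
  define s where "s q = (if q \<in> U \<inter> G then \<gamma> q *\<^sub>R \<Phi> (\<sigma> q) else 0)" for q
  have \<sigma>: "section_on B U \<sigma>" using par by (simp add: parallel_section_on_def)
  have "smooth_map (base B) euclidean_atlas (U \<inter> G) (\<lambda>q. \<Phi> (\<sigma> q))"
    using \<sigma> G(2) by (intro smooth_triv_section[OF triv _ oUG]) (auto simp: section_on_def intro: smooth_map_subset)
  then have "smooth_map (base B) euclidean_atlas (U \<inter> G) (\<lambda>q. \<gamma> q *\<^sub>R \<Phi> (\<sigma> q))"
    using \<gamma>(1) by (intro smooth_map_scaleR cov_base oUG) (auto simp: smooth_functions_def intro: smooth_map_subset)
  then have s: "smooth_map (base B) euclidean_atlas UNIV s"
    unfolding s_def using \<gamma>(4)
    by (intro smooth_map_extend[OF cov_base cov_euclid oUG \<gamma>(2,3)] smooth_map_const_euclidean[OF cov_base]) auto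
  have "cut_section s q = \<sigma> q" if "q \<in> G'" for q
  proof -
    have q: "q \<in> V1" "q \<in> U" "q \<in> G" using that G'(3) G(2) by auto
    then have "cut_section s q = lift V1 \<Phi> q (\<Phi> (\<sigma> q))"
      using G'(4)[OF that] G(3) by (simp add: cut_section_def s_def)
    then show ?thesis using lift_triv[OF triv q(1) section_in_fibre[OF \<sigma> q(2)]] by simp
  qed
  then have "D (cfield v) (cut_section s) p = fzero B p"
    using G' by (intro parallel_imp_connection_zero[OF par cfield_vector_field section_cut_section[OF s], of G']) auto
  then have "0 = frechet_derivative (\<lambda>x. s (inv_into V \<phi> x)) (at (\<phi> p)) v + (\<Sum>b\<in>Basis. (s p \<bullet> b) *\<^sub>R conn_form v b p)"
    using connection_cut_section[OF p(1) s, of v] triv_fzero[OF triv, of p] p(1) G(2) by auto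
  moreover have "s p = \<Phi> (\<sigma> p)" using G' p by (simp add: s_def)
  moreover have "frechet_derivative (\<lambda>x. s (inv_into V \<phi> x)) (at (\<phi> p)) = frechet_derivative (\<lambda>x. \<Phi> (\<sigma> (inv_into V \<phi> x))) (at (\<phi> p))"
  proof (rule frechet_derivative_transform_within_open)
    show "(\<lambda>x. s (inv_into V \<phi> x)) differentiable (at (\<phi> p))"
      using smooth_on_differentiable[OF smooth_function_in_chart[OF s chart], of "\<phi> p"] p G(2)
      by (auto simp: differentiable_def)
    show "open (\<phi> ` (V \<inter> G'))" by (rule chart_image_Int_open[OF cov_base G'(1) chart])
    show "\<phi> p \<in> \<phi> ` (V \<inter> G')" using G' p G by auto
    show "s (inv_into V \<phi> x) = \<Phi> (\<sigma> (inv_into V \<phi> x))" if "x \<in> \<phi> ` (V \<inter> G')" for x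
      using that ch(7) G' by (auto simp: s_def subset_eq)
  qed
  ultimately show ?thesis by (simp add: sum_negf eq_neg_iff_add_eq_0)
qed

end

section \<open>Extension of parallel sections\<close>

text \<open>
  In a slice chart, the part of the complement of \<open>U\<close> that lies in a small ball is contained in the subspace \<open>L\<close>. That the
  extension is parallel need not be recorded: it follows later by density.
\<close>

lemma parallel_section_extends_locally:
  assumes par: "parallel_section_on B D U \<sigma>" and U: "open U"
    and N: "embedded_submanifold (base B) k N" "k \<ge> 2" "- U \<subseteq> N"
  shows "\<exists>W t. open W \<and> p \<in> W \<and> section_on B W t \<and> (\<forall>q\<in>W \<inter> U. t q = \<sigma> q)"
proof (cases "p \<in> U")
  case True
  then show ?thesis using par U by (auto simp: parallel_section_on_def)
next
  case False
  then have "p \<in> N" using N(3) by auto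
  then obtain V \<phi> L where V: "(V, \<phi>) \<in> base B" "p \<in> V" and L: "subspace L" "dim L + k = DIM('x)"
      and VN: "\<phi> ` (V \<inter> N) = \<phi> ` V \<inter> L"
    using N(1) unfolding embedded_submanifold_def by blast
  note ch = is_chart_simps[OF charts_coverD[OF cov_base V(1)]]
  obtain V1 \<Phi> where V1: "p \<in> V1" and triv: "local_trivialization B V1 \<Phi>" by (rule exists_trivialization)
  have "open (V \<inter> V1)" using ch(1) triv_open[OF triv] by auto
  then obtain \<beta> K G where \<beta>: "\<beta> \<in> smooth_functions (base B)"
    and K: "closed K" "K \<subseteq> V \<inter> V1" "\<And>q. q \<notin> K \<Longrightarrow> \<beta> q = 0"
    and G: "open G" "G \<subseteq> V \<inter> V1" "\<And>q. q \<in> G \<Longrightarrow> \<beta> q = 1" and pG: "p \<in> G"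
    using exists_smooth_bump[OF atlas_base, of "V \<inter> V1" p] V(2) V1 by (metis IntI)
  note ctx = triv V(1) \<beta> K G
  have GV: "G \<inter> V = G" "V \<inter> G = G" using G(2) by auto
  have oG: "open (\<phi> ` G)" using chart_image_Int_open[OF cov_base G(1) V(1)] by (simp add: GV)
  obtain r where r: "r > 0" "cball (\<phi> p) r \<subseteq> \<phi> ` G"
    using oG pG by (meson image_eqI open_contains_cball)
  have br: "ball (\<phi> p) r \<subseteq> \<phi> ` G" using r(2) ball_subset_cball by blast
  define S where "S = ball (\<phi> p) r \<inter> \<phi> ` (V \<inter> U)"
  have oS: "open S" unfolding S_def using chart_image_Int_open[OF cov_base U V(1)] by auto
  let ?s = "\<lambda>x. \<Phi> (\<sigma> (inv_into V \<phi> x))"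
  let ?a = "\<lambda>i b x. - conn_form V1 \<Phi> V \<phi> \<beta> i b (inv_into V \<phi> x)"
  have inS: "\<exists>q. x = \<phi> q \<and> q \<in> V \<and> q \<in> U \<and> q \<in> G" if "x \<in> S" for x
  proof -
    from that obtain q where q: "x = \<phi> q" "q \<in> V" "q \<in> U" "\<phi> q \<in> \<phi> ` G" using br unfolding S_def by blast
    then have "q \<in> G" using inj_onD[OF ch(6)] G(2) by blast
    with q show ?thesis by blast
  qed
  have \<sigma>: "section_on B U \<sigma>" using par by (simp add: parallel_section_on_def)
  have "\<exists>\<tau>. smooth_on (ball (\<phi> p) r) \<tau> \<and> (\<forall>x\<in>S. \<tau> x = ?s x)"
  proof (rule extend_solution_across_subspace[OF L(1) _ oS, where a = ?a and T = "\<phi> ` G"])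
    show "dim L + 2 \<le> DIM('x)" using L(2) N(2) by simp
    show "S \<subseteq> ball (\<phi> p) r" by (simp add: S_def)
    show "ball (\<phi> p) r - L \<subseteq> S"
    proof
      fix x assume x: "x \<in> ball (\<phi> p) r - L"
      then obtain q where q: "x = \<phi> q" "q \<in> G" using br by blast
      then have "q \<in> V" using G(2) by auto
      moreover have "q \<in> U" using q x VN N(3) \<open>q \<in> V\<close> by blast
      ultimately show "x \<in> S" using q x by (auto simp: S_def)
    qed
    show "cball (\<phi> p) r \<subseteq> \<phi> ` G" by (rule r)
    have oUG: "open (U \<inter> G)" using U G by auto
    have "smooth_map (base B) euclidean_atlas (U \<inter> G) (\<lambda>q. \<Phi> (\<sigma> q))"
      using \<sigma> G(2) by (intro smooth_triv_section[OF triv _ oUG]) (auto simp: section_on_def intro: smooth_map_subset)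
    then have "smooth_on (\<phi> ` (V \<inter> (U \<inter> G))) ?s"
      using V(1) by (simp add: smooth_map_to_euclidean_iff[OF cov_base oUG])
    then show "smooth_on S ?s" by (rule smooth_on_subset) (use inS in blast)
    show "smooth_on (\<phi> ` G) (?a i b)" for i b
    proof -
      have "smooth_map (base B) euclidean_atlas V1 (conn_form V1 \<Phi> V \<phi> \<beta> i b)"
        by (rule smooth_conn_form[OF ctx])
      then have "smooth_map (base B) euclidean_atlas G (conn_form V1 \<Phi> V \<phi> \<beta> i b)"
        by (rule smooth_map_subset) (use G(2) in auto)
      then have "smooth_on (\<phi> ` G) (\<lambda>x. conn_form V1 \<Phi> V \<phi> \<beta> i b (inv_into V \<phi> x))"
        using V(1) by (metis GV(2) smooth_map_to_euclidean_iff[OF cov_base G(1)])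
      then show ?thesis by (rule smooth_on_linear_compose[OF bounded_linear_minus[OF bounded_linear_ident] oG])
    qed
    show "frechet_derivative ?s (at x) i = (\<Sum>b\<in>Basis. (?s x \<bullet> b) *\<^sub>R ?a i b x)" if "x \<in> S" for x i
    proof -
      obtain q where q: "x = \<phi> q" "q \<in> V" "q \<in> U" "q \<in> G" using inS \<open>x \<in> S\<close> by blast
      show ?thesis
        using parallel_local_equation[OF ctx par U q(4,3), of i] ch(7)[OF q(2)] by (simp add: q(1))
    qed
  qed
  then obtain \<tau> where \<tau>: "smooth_on (ball (\<phi> p) r) \<tau>" "\<And>x. x \<in> S \<Longrightarrow> \<tau> x = ?s x" by blast
  define W where "W = V \<inter> \<phi> -` ball (\<phi> p) r"
  have oW: "open W" unfolding W_def using ch by (intro continuous_open_preimage) auto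
  have WG: "W \<subseteq> G"
  proof
    fix q assume q: "q \<in> W"
    then obtain q' where "q' \<in> G" "\<phi> q = \<phi> q'" using br unfolding W_def by blast
    then show "q \<in> G" using inj_onD[OF ch(6), of q q'] q G(2) unfolding W_def by blast
  qed
  have WV1: "W \<subseteq> V1" using WG G(2) by blast
  have \<phi>W: "smooth_map (base B) euclidean_atlas W \<phi>"
    by (rule smooth_map_subset[OF smooth_map_chart[OF atlas_base V(1)]]) (simp add: W_def)
  have "smooth_map euclidean_atlas euclidean_atlas (ball (\<phi> p) r) \<tau>"
    using \<tau>(1) by (simp add: smooth_map_euclidean_iff)
  from smooth_map_compose[OF cov_base cov_euclid cov_euclid oW open_ball \<phi>W this]
  have "smooth_map (base B) euclidean_atlas W (\<lambda>q. \<tau> (\<phi> q))" by (auto simp: W_def)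
  then have "section_on B W (\<lambda>q. lift V1 \<Phi> q (\<tau> (\<phi> q)))"
    by (rule section_lift[OF triv _ oW WV1])
  moreover have "lift V1 \<Phi> q (\<tau> (\<phi> q)) = \<sigma> q" if "q \<in> W \<inter> U" for q
  proof -
    have "\<phi> q \<in> S" "q \<in> V" using that by (auto simp: W_def S_def)
    then have "\<tau> (\<phi> q) = \<Phi> (\<sigma> q)" using \<tau>(2) ch(7) by simp
    then show ?thesis using that WV1 lift_triv[OF triv, of q "\<sigma> q"] section_in_fibre[OF \<sigma>] by auto
  qed
  moreover have "p \<in> W" using V(2) r(1) by (simp add: W_def)
  ultimately show ?thesis using oW by blast
qed

theorem parallel_section_extends:
  assumes par: "parallel_section_on B D U \<sigma>" and U: "open U"
    and N: "embedded_submanifold (base B) k N" "k \<ge> 2" "- U \<subseteq> N"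
  shows "\<exists>\<tau>. section_on B UNIV \<tau> \<and>
             (\<forall>X. vector_field_on (base B) UNIV X \<longrightarrow> (\<forall>p. D X \<tau> p = fzero B p)) \<and>
             (\<forall>p\<in>U. \<tau> p = \<sigma> p)"
proof -
  note dense = complement_of_submanifold_dense[OF atlas_base N]
  obtain W t where Wt: "\<And>p. open (W p)" "\<And>p. p \<in> W p" "\<And>p. section_on B (W p) (t p)"
      "\<And>p q. q \<in> W p \<Longrightarrow> q \<in> U \<Longrightarrow> t p q = \<sigma> q"
    using parallel_section_extends_locally[OF par U N] by (metis IntI)
  define \<tau> where "\<tau> p = t p p" for p
  have ct: "continuous_on (W p) (t p)" for p
    using Wt(3) smooth_mapD(1) unfolding section_on_def by blast
  \<comment> \<open>The local extensions agree on overlaps because they all agree with \<open>\<sigma>\<close> on the dense set \<open>U\<close>.\<close>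
  have \<tau>t: "\<tau> q = t p q" if "q \<in> W p" for p q
    unfolding \<tau>_def
  proof (rule continuous_eq_on_dense[where W = "W p \<inter> W q" and f = "t q" and g = "t p" and p = q, OF dense])
    show "continuous_on (W p \<inter> W q) (t q)" "continuous_on (W p \<inter> W q) (t p)"
      using ct continuous_on_subset by blast+
  qed (use Wt that in auto)
  have sec: "section_on B UNIV \<tau>"
    unfolding section_on_def
  proof (intro conjI ballI)
    show "\<tau> p \<in> fibre B p" for p unfolding \<tau>_def using Wt(2,3) section_in_fibre by blast
    show "smooth_map (base B) (total B) UNIV \<tau>"
    proof (rule smooth_map_local[OF cov_base cov_total])
      fix p
      have "smooth_map (base B) (total B) (W p) \<tau>"
        by (rule smooth_map_cong[OF cov_base cov_total Wt(1), where f = "t p"])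
           (use \<tau>t Wt(3) in \<open>auto simp: section_on_def\<close>)
      then show "\<exists>G. open G \<and> p \<in> G \<and> smooth_map (base B) (total B) G \<tau>" using Wt(1,2) by blast
    qed
  qed
  have eq: "\<tau> p = \<sigma> p" if "p \<in> U" for p using Wt(2,4) that by (simp add: \<tau>_def)
  \<comment> \<open>Both sides are continuous sections, and they agree on \<open>U\<close>.\<close>
  have "D X \<tau> p = fzero B p" if X: "vector_field_on (base B) UNIV X" for X p
  proof (rule continuous_eq_on_dense[where f = "D X \<tau>" and g = "fzero B", OF dense open_UNIV])
    show "continuous_on UNIV (D X \<tau>)" "continuous_on UNIV (fzero B)"
      using connection_section[OF X sec] section_fzero smooth_mapD(1) unfolding section_on_def by blast+
    show "D X \<tau> q = fzero B q" if "q \<in> U" for q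
      by (rule parallel_imp_connection_zero[OF par X sec U that]) (use eq in auto)
  qed auto
  with sec eq show ?thesis by blast
qed

end

theorem theorem1:
  fixes B :: "('m::{t2_space, second_countable_topology}, 'e::{t2_space, second_countable_topology},
               'x::euclidean_space, 'f::euclidean_space) vbundle"
    and D :: "'m vfield \<Rightarrow> ('m \<Rightarrow> 'e) \<Rightarrow> 'm \<Rightarrow> 'e"
    and U N :: "'m set" and k :: nat and \<sigma> :: "'m \<Rightarrow> 'e"
  assumes "vector_bundle B"
    and "connected (UNIV :: 'm set)"
    and "linear_connection B D"
    and "open U"
    and "parallel_section_on B D U \<sigma>"
    and "\<exists>p\<in>U. \<sigma> p \<noteq> fzero B p"
    and "embedded_submanifold (base B) k N" and "k \<ge> 2"
    and "- U \<subseteq> N"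
  shows "\<exists>\<tau>. section_on B UNIV \<tau> \<and>
             (\<forall>X. vector_field_on (base B) UNIV X \<longrightarrow> (\<forall>p. D X \<tau> p = fzero B p)) \<and>
             (\<forall>p\<in>U. \<tau> p = \<sigma> p)"
proof -
  interpret bundle_with_connection B D by unfold_locales fact+
  show ?thesis by (rule parallel_section_extends) fact+
qed

end
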